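(* Assume that $n\ge 3$. Let $P\subset\mathbb{R}^n$ be a centrally symmetric polytope (centered at the origin) with rational vertices and nonempty interior. Then there exists a function $a\in C^\infty(\mathbb{T}^n,(0,\infty))$ such that $D_a=P$.
   Context: $\mathbb{T}^n=\mathbb{R}^n/\mathbb{Z}^n$; functions on $\mathbb{T}^n$ are identified with $\mathbb{Z}^n$-periodic functions on $\mathbb{R}^n$. A nonzero vector $q\in\mathbb{R}^n$ is called rational if $sq$ has integer coordinates for some real $s>0$; a polytope has rational vertices if each of its vertices is a rational vector. All polytopes are centered at the origin. Let $a:\mathbb{R}^n\to(0,\infty)$ be continuous, $\mathbb{Z}^n$-periodic and non-constant (standing assumption on $a$). For $t>0$ and $x\in\mathbb{R}^n$ the reachable set $\mathcal{R}_t(x)$ is the set of all $y\in\mathbb{R}^n$ for which there is $\gamma\in W^{1,\infty}([0,t],\mathbb{R}^n)$ with $\gamma(0)=x$, $\gamma(t)=y$ and $|\dot\gamma(s)|\le a(\gamma(s))$ for a.e. $s\in[0,t]$. It is a known fact that there is a compact convex set $D_a\subset\mathbb{R}^n$, independent of $x$, such that $\frac1t\mathcal{R}_t(x)\to D_a$ as $t\to\infty$ in the Hausdorff distance, for every $x\in\mathbb{R}^n$; this defines $D_a$. Equivalently, $D_a$ is the compact convex set whose support function is the effective Hamiltonian $\overline H$: for each $p\in\mathbb{R}^n$, $\sup_{q\in D_a}p\cdot q=\overline H(p)$, where $\overline H(p)$ is the unique real number such that $a(y)|p+Dv(y)|=\overline H(p)$ in $\mathbb{T}^n$ admits a continuous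 viscosity solution $v$. *)

theory Defs
  imports "HOL-Analysis.Analysis"
begin

text \<open>
  Functions of class \<open>C\<^sup>k\<close> on the whole space. In finite dimension, continuity of the
  derivative as a map into linear maps is the same as continuity of all directional derivatives,
  and it is the latter that the recursion uses.
\<close>

primrec C_class :: "nat \<Rightarrow> ('a::euclidean_space \<Rightarrow> 'b::real_normed_vector) \<Rightarrow> bool" where
  "C_class 0 f \<longleftrightarrow> continuous_on UNIV f"
| "C_class (Suc k) f \<longleftrightarrow>
     (\<forall>x. f differentiable (at x)) \<and>
     (\<forall>v. C_class k (\<lambda>x. frechet_derivative f (at x) v))"

definition smooth :: "('a::euclidean_space \<Rightarrow> 'b::real_normed_vector) \<Rightarrow> bool" where
  "smooth f \<longleftrightarrow> (\<forall>k. C_class k f)"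

definition integer_vector :: "real ^ 'n \<Rightarrow> bool" where
  "integer_vector z \<longleftrightarrow> (\<forall>i. z $ i \<in> \<int>)"

text \<open>Functions on the torus are represented by their periodic lifts.\<close>

definition torus_periodic :: "(real ^ 'n \<Rightarrow> 'b) \<Rightarrow> bool" where
  "torus_periodic f \<longleftrightarrow> (\<forall>x z. integer_vector z \<longrightarrow> f (x + z) = f x)"

text \<open>Rationality is a property of the direction: some positive \<^emph>\<open>real\<close> multiple is integral.\<close>

definition rational_vector :: "real ^ 'n \<Rightarrow> bool" where
  "rational_vector q \<longleftrightarrow> q \<noteq> 0 \<and> (\<exists>s>0. integer_vector (s *\<^sub>R q))"

definition has_rational_vertices :: "(real ^ 'n) set \<Rightarrow> bool" where
  "has_rational_vertices P \<longleftrightarrow> (\<forall>q. q extreme_point_of P \<longrightarrow> rational_vector q)"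

definition centrally_symmetric :: "'a::real_vector set \<Rightarrow> bool" where
  "centrally_symmetric P \<longleftrightarrow> uminus ` P = P"

definition test_function :: "real \<Rightarrow> (real \<Rightarrow> real) \<Rightarrow> bool" where
  "test_function t \<phi> \<longleftrightarrow> smooth \<phi> \<and> closure {s. \<phi> s \<noteq> 0} \<subseteq> {0<..<t}"

text \<open>
  The curve \<open>\<gamma>\<close>, restricted to \<open>[0,t]\<close>, belongs to \<open>W\<^sup>1\<^sup>,\<^sup>\<infinity>\<close> with weak derivative \<open>g\<close>. Since
  endpoint values matter, \<open>\<gamma>\<close> is required to be the continuous representative, which is
  automatically bounded on \<open>[0,t]\<close>.
\<close>

definition W1_inf_curve :: "real \<Rightarrow> (real \<Rightarrow> real ^ 'n) \<Rightarrow> (real \<Rightarrow> real ^ 'n) \<Rightarrow> bool" where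
  "W1_inf_curve t \<gamma> g \<longleftrightarrow>
     continuous_on {0..t} \<gamma> \<and>
     g \<in> borel_measurable (lebesgue_on {0..t}) \<and>
     (\<exists>C. AE s in lebesgue_on {0..t}. norm (g s) \<le> C) \<and>
     (\<forall>\<phi>. test_function t \<phi> \<longrightarrow>
        (LINT s|lebesgue_on {0..t}. deriv \<phi> s *\<^sub>R \<gamma> s) =
        - (LINT s|lebesgue_on {0..t}. \<phi> s *\<^sub>R g s))"

definition reachable_set :: "(real ^ 'n \<Rightarrow> real) \<Rightarrow> real \<Rightarrow> real ^ 'n \<Rightarrow> (real ^ 'n) set" where
  "reachable_set a t x =
     {y. \<exists>\<gamma> g. W1_inf_curve t \<gamma> g \<and> \<gamma> 0 = x \<and> \<gamma> t = y \<and>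
               (AE s in lebesgue_on {0..t}. norm (g s) \<le> a (\<gamma> s))}"

text \<open>
  Extended values avoid the junk values of real suprema and infima: the distance between
  an empty and a nonempty set is \<open>\<infinity>\<close>.
\<close>

definition hausdorff_dist :: "'a::metric_space set \<Rightarrow> 'a set \<Rightarrow> ennreal" where
  "hausdorff_dist A B =
     max (SUP x\<in>A. INF y\<in>B. ennreal (dist x y)) (SUP y\<in>B. INF x\<in>A. ennreal (dist x y))"

text \<open>
  \<open>has_limit_shape a D\<close> says that \<open>D\<^sub>a\<close> exists and equals \<open>D\<close>; see \<open>has_limit_shape_unique\<close>.
\<close>

definition has_limit_shape :: "(real ^ 'n \<Rightarrow> real) \<Rightarrow> (real ^ 'n) set \<Rightarrow> bool" where
  "has_limit_shape a D \<longleftrightarrow>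
     compact D \<and> convex D \<and>
     (\<forall>x. ((\<lambda>t. hausdorff_dist ((\<lambda>y. y /\<^sub>R t) ` reachable_set a t x) D) \<longlongrightarrow> 0) at_top)"

lemma hausdorff_dist_lessD:
  assumes "hausdorff_dist A B < ennreal e"
  shows "x \<in> A \<Longrightarrow> \<exists>y\<in>B. dist x y < e" and "y \<in> B \<Longrightarrow> \<exists>x\<in>A. dist x y < e"
proof -
  have 1: "(SUP x\<in>A. INF y\<in>B. ennreal (dist x y)) < ennreal e"
    and 2: "(SUP y\<in>B. INF x\<in>A. ennreal (dist x y)) < ennreal e"
    using assms by (auto simp: hausdorff_dist_def)
  show "\<exists>y\<in>B. dist x y < e" if "x \<in> A"
  proof -
    have "(INF y\<in>B. ennreal (dist x y)) < ennreal e"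
      using 1 that by (meson SUP_upper le_less_trans)
    then show ?thesis
      by (auto simp: INF_less_iff ennreal_less_iff)
  qed
  show "\<exists>x\<in>A. dist x y < e" if "y \<in> B"
  proof -
    have "(INF x\<in>A. ennreal (dist x y)) < ennreal e"
      using 2 that by (meson SUP_upper le_less_trans)
    then show ?thesis
      by (auto simp: INF_less_iff ennreal_less_iff)
  qed
qed

lemma has_limit_shape_subset:
  assumes D: "has_limit_shape a D" and E: "has_limit_shape a E"
  shows "D \<subseteq> E"
proof
  fix q assume q: "q \<in> D"
  define R where "R t = (\<lambda>y. y /\<^sub>R t) ` reachable_set a t 0" for t
  have "\<exists>s\<in>E. dist s q < e" if "e > 0" for e :: real
  proof -
    have pos: "0 < ennreal (e / 2)" using that by simp
    have "\<forall>\<^sub>F t in at_top. hausdorff_dist (R t) D < ennreal (e / 2)"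
      using D pos order_tendstoD(2) unfolding has_limit_shape_def R_def by blast
    moreover have "\<forall>\<^sub>F t in at_top. hausdorff_dist (R t) E < ennreal (e / 2)"
      using E pos order_tendstoD(2) unfolding has_limit_shape_def R_def by blast
    ultimately have "\<forall>\<^sub>F t in at_top. hausdorff_dist (R t) D < ennreal (e / 2) \<and>
        hausdorff_dist (R t) E < ennreal (e / 2)"
      by (rule eventually_conj)
    then obtain t :: real where t: "hausdorff_dist (R t) D < ennreal (e / 2)"
        "hausdorff_dist (R t) E < ennreal (e / 2)"
      using eventually_happens trivial_limit_at_top_linorder by blast
    obtain r where r: "r \<in> R t" "dist r q < e / 2"
      using hausdorff_dist_lessD(2)[OF t(1) q] by blast
    obtain s where s: "s \<in> E" "dist r s < e / 2"
      using hausdorff_dist_lessD(1)[OF t(2) r(1)] by blast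
    have "dist s q < e"
      using r(2) s(2) dist_triangle_half_r by blast
    then show ?thesis using s(1) by blast
  qed
  then have "q \<in> closure E" by (simp add: closure_approachable)
  moreover have "closed E"
    using E by (simp add: has_limit_shape_def compact_imp_closed)
  ultimately show "q \<in> E" by simp
qed

lemma has_limit_shape_unique:
  "has_limit_shape a D \<Longrightarrow> has_limit_shape a E \<Longrightarrow> D = E"
  by (simp add: has_limit_shape_subset subset_antisym)

end

theory Submission
  imports Defs
begin

text \<open>
  For every vertex \<open>q\<close> of \<open>P\<close> take a closed geodesic of the torus in direction \<open>q\<close>. Since
  \<open>n \<ge> 3\<close> these geodesics can be translated so as to be pairwise disjoint. Let \<open>a = \<bar>q\<bar>\<close> on the
  geodesic of \<open>q\<close>, \<open>a \<le> \<bar>q\<bar>\<close> in a thin tube around it, and \<open>a = \<epsilon>\<close> outside the tubes. Running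
  along the geodesics, and changing between them in bounded time, reaches \<open>x + t z + O(1)\<close> for each
  convex combination \<open>z\<close> of vertices. Conversely, let \<open>p \<bullet> z \<le> 1\<close> on \<open>P\<close>. The function that
  maps a point of a tube to the value of \<open>p\<close> at its projection to the core line is Lipschitz; extend
  it to a Lipschitz function \<open>u\<close> on the whole space. Then \<open>u\<close> has slope
  \<open>\<bar>p \<bullet> q\<bar> / \<bar>q\<bar> \<le> 1 / \<bar>q\<bar>\<close> in the tube of \<open>q\<close> (here the symmetry of \<open>P\<close> enters), so \<open>u\<close> grows at
  most at unit speed along admissible curves if \<open>\<epsilon>\<close> is small. As \<open>u\<close> stays at bounded distance from
  \<open>p\<close>, this confines reachable sets to \<open>x + (t + C) P\<close>.
\<close>

section \<open>Smooth functions\<close>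

lemma C_class_continuous: "C_class k f \<Longrightarrow> continuous_on UNIV f"
  by (cases k) (auto simp: continuous_at_imp_continuous_on differentiable_imp_continuous_within)

lemma C_class_Suc_imp: "C_class (Suc k) f \<Longrightarrow> C_class k f"
proof (induction k arbitrary: f)
  case 0
  then show ?case using C_class_continuous[OF 0] by (simp only: C_class.simps)
next
  case (Suc k)
  from Suc.prems have "f differentiable (at x)" for x by simp
  moreover have "C_class k (\<lambda>x. frechet_derivative f (at x) v)" for v
    using Suc.prems by (intro Suc.IH) simp
  ultimately show ?case by simp
qed

text \<open>\<open>C_class\<close> is phrased with the choice operator
  \<open>frechet_derivative\<close>; by uniqueness of derivatives any explicitly known derivative
  may stand in for it.\<close>

lemma C_class_SucI:
  assumes "\<And>x. (f has_derivative f' x) (at x)" and "\<And>v. C_class k (\<lambda>x. f' x v)"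
  shows "C_class (Suc k) f"
proof -
  have "frechet_derivative f (at x) = f' x" for x
    using frechet_derivative_at[OF assms(1)] by (rule sym)
  moreover have "f differentiable at x" for x
    using assms(1) unfolding differentiable_def by blast
  ultimately show ?thesis using assms(2) by simp
qed

lemma C_class_SucD:
  assumes "C_class (Suc k) f"
  shows "(f has_derivative frechet_derivative f (at x)) (at x)"
    and "C_class k (\<lambda>x. frechet_derivative f (at x) v)"
  using assms by (simp_all flip: frechet_derivative_works)

lemma C_class_const: "C_class k (\<lambda>x. c)"
proof (induction k arbitrary: c)
  case (Suc k)
  show ?case by (rule C_class_SucI[where f' = "\<lambda>x v. 0"]) (auto simp: Suc)
qed simp

lemma C_class_linear:
  assumes "bounded_linear f" shows "C_class k f"
proof (cases k)
  case 0
  then show ?thesis using assms by (simp add: linear_continuous_on)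
next
  case (Suc j)
  show ?thesis unfolding Suc
    by (rule C_class_SucI[where f' = "\<lambda>x. f"])
      (auto simp: C_class_const bounded_linear_imp_has_derivative assms)
qed

lemma C_class_add:
  "C_class k f \<Longrightarrow> C_class k g \<Longrightarrow> C_class k (\<lambda>x. f x + g x)"
proof (induction k arbitrary: f g)
  case (Suc k)
  note D = C_class_SucD[OF Suc.prems(1)] C_class_SucD[OF Suc.prems(2)]
  show ?case
    by (rule C_class_SucI[OF has_derivative_add[OF D(1,3)]]) (intro Suc.IH D(2,4))
qed (auto intro: continuous_intros)

lemma C_class_mult:
  fixes f g :: "'a::euclidean_space \<Rightarrow> real"
  shows "C_class k f \<Longrightarrow> C_class k g \<Longrightarrow> C_class k (\<lambda>x. f x * g x)"
proof (induction k arbitrary: f g)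
  case (Suc k)
  note D = C_class_SucD[OF Suc.prems(1)] C_class_SucD[OF Suc.prems(2)]
  note S = C_class_Suc_imp[OF Suc.prems(1)] C_class_Suc_imp[OF Suc.prems(2)]
  show ?case
    by (rule C_class_SucI[OF has_derivative_mult[OF D(1,3)]])
      (intro C_class_add Suc.IH S D(2,4))
qed (auto intro: continuous_intros)

text \<open>A linear map on the reals is multiplication by its value at 1. This turns the chain rule
  into a product of real functions, to which the induction hypothesis and
  \<open>C_class_mult\<close> apply.\<close>

lemma C_class_compose:
  fixes f :: "real \<Rightarrow> real" and g :: "'a::euclidean_space \<Rightarrow> real"
  shows "C_class k f \<Longrightarrow> C_class k g \<Longrightarrow> C_class k (\<lambda>x. f (g x))"
proof (induction k arbitrary: f g)
  case 0
  then show ?case using continuous_on_compose2[of UNIV f UNIV g] by simp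
next
  case (Suc k)
  note D = C_class_SucD[OF Suc.prems(1)] C_class_SucD[OF Suc.prems(2)]
  note S = C_class_Suc_imp[OF Suc.prems(1)] C_class_Suc_imp[OF Suc.prems(2)]
  have lin: "linear (frechet_derivative f (at y))" for y
    by (rule has_derivative_linear[OF D(1)])
  have 1: "frechet_derivative f (at y) z = frechet_derivative f (at y) 1 * z" for y z
    using linear_scale[OF lin, of y z 1] by (simp add: mult.commute)
  have "(\<lambda>x. frechet_derivative f (at (g x)) (frechet_derivative g (at x) v)) =
      (\<lambda>x. frechet_derivative f (at (g x)) 1 * frechet_derivative g (at x) v)" for v
    by (rule ext) (rule 1)
  moreover have "C_class k (\<lambda>x. frechet_derivative f (at (g x)) 1 * frechet_derivative g (at x) v)" for v
    by (rule C_class_mult[OF Suc.IH[OF D(2) S(2)] D(4)])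
  ultimately have "C_class k (\<lambda>x. frechet_derivative f (at (g x)) (frechet_derivative g (at x) v))" for v
    by (simp only:)
  then show ?case
    by (rule C_class_SucI[OF has_derivative_compose[OF D(3,1)]])
qed

lemma C_class_real_SucI:
  assumes "\<And>x. (f has_real_derivative f' x) (at x)" and "C_class k f'"
  shows "C_class (Suc k) f"
  by (rule C_class_SucI[OF assms(1)[unfolded has_field_derivative_def]])
    (rule C_class_mult[OF assms(2) C_class_const])

lemma smooth_const: "smooth (\<lambda>x. c)"
  by (simp add: smooth_def C_class_const)

lemma smooth_linear: "bounded_linear f \<Longrightarrow> smooth f"
  by (simp add: smooth_def C_class_linear)

lemma smooth_add: "smooth f \<Longrightarrow> smooth g \<Longrightarrow> smooth (\<lambda>x. f x + g x)"
  by (simp add: smooth_def C_class_add)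

lemma smooth_mult:
  fixes f g :: "'a::euclidean_space \<Rightarrow> real"
  shows "smooth f \<Longrightarrow> smooth g \<Longrightarrow> smooth (\<lambda>x. f x * g x)"
  by (simp add: smooth_def C_class_mult)

lemma smooth_compose:
  fixes f :: "real \<Rightarrow> real" and g :: "'a::euclidean_space \<Rightarrow> real"
  shows "smooth f \<Longrightarrow> smooth g \<Longrightarrow> smooth (\<lambda>x. f (g x))"
  by (simp add: smooth_def C_class_compose)

lemma smooth_diff:
  fixes f g :: "'a::euclidean_space \<Rightarrow> real"
  assumes "smooth f" "smooth g"
  shows "smooth (\<lambda>x. f x - g x)"
  using smooth_add[OF assms(1) smooth_mult[OF smooth_const[of "-1"] assms(2)]] by simp

lemma smooth_sum:
  fixes f :: "'i \<Rightarrow> 'a::euclidean_space \<Rightarrow> real"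
  assumes "\<And>i. i \<in> I \<Longrightarrow> smooth (f i)"
  shows "smooth (\<lambda>x. \<Sum>i\<in>I. f i x)"
  using assms
proof (induction I rule: infinite_finite_induct)
  case (insert i I)
  then show ?case using smooth_add[of "f i" "\<lambda>x. \<Sum>i\<in>I. f i x"] by simp
qed (simp_all add: smooth_const)

lemma smooth_continuous: "smooth f \<Longrightarrow> continuous_on UNIV f"
  unfolding smooth_def using C_class_continuous by blast

lemma smooth_real_derivative:
  fixes f :: "real \<Rightarrow> real"
  assumes "smooth f"
  shows "(f has_real_derivative deriv f x) (at x)" and "continuous_on UNIV (deriv f)"
proof -
  have 1: "C_class (Suc 0) f" using assms unfolding smooth_def by blast
  show D: "(f has_real_derivative deriv f x) (at x)" for x
    using 1 by (simp add: DERIV_deriv_iff_real_differentiable)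
  have "frechet_derivative f (at x) 1 = deriv f x" for x
    using frechet_derivative_at[OF D[unfolded has_field_derivative_def], symmetric] by simp
  then show "continuous_on UNIV (deriv f)"
    using C_class_SucD(2)[OF 1, of 1] by simp
qed

lemma smooth_cos: "smooth (cos :: real \<Rightarrow> real)"
proof -
  have "C_class k (sin :: real \<Rightarrow> real) \<and> C_class k (cos :: real \<Rightarrow> real)" for k
  proof (induction k)
    case (Suc k)
    have "C_class k (\<lambda>x::real. - sin x)"
      using C_class_mult[OF C_class_const[of k "-1"] conjunct1[OF Suc]] by simp
    with Suc show ?case
      using C_class_real_SucI[OF DERIV_sin] C_class_real_SucI[OF DERIV_cos] by blast
  qed (auto intro: continuous_intros)
  then show ?thesis by (simp add: smooth_def)
qed

section \<open>A smooth monotone step function\<close>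

definition flat_pow :: "nat \<Rightarrow> real \<Rightarrow> real" where
  "flat_pow j x = (if x > 0 then inverse x ^ j * exp (- inverse x) else 0)"

text \<open>One term of the exponential series at \<open>y = 1 / x\<close> gives
  \<open>y ^ (j+2) \<le> fact (j+2) * exp y\<close>. The resulting quadratic decay makes the
  difference quotients at 0 tend to 0.\<close>

lemma flat_pow_le_square: "\<bar>flat_pow j x\<bar> \<le> fact (j + 2) * x\<^sup>2"
proof (cases "x > 0")
  case True
  define y where "y = inverse x"
  have y: "y > 0" "x = inverse y" using True by (auto simp: y_def)
  have "inverse (fact (j+2)) * y ^ (j+2) \<le> (\<Sum>n. inverse (fact n) * y ^ n)"
    using sum_le_suminf[OF summable_exp, of "{j+2}" y] y(1) by simp
  also have "\<dots> = exp y"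
    using exp_converges[of y] by (simp add: sums_iff)
  finally have "y ^ (j+2) \<le> fact (j+2) * exp y"
    by (simp add: field_simps del: fact_Suc power_Suc)
  then have "x\<^sup>2 * (y ^ j * y\<^sup>2) * exp (- y) \<le> x\<^sup>2 * (fact (j+2) * exp y) * exp (- y)"
    unfolding power_add by (intro mult_right_mono mult_left_mono) auto
  moreover have "x\<^sup>2 * (y ^ j * y\<^sup>2) = y ^ j"
    using y by (simp add: power_inverse)
  moreover have "x\<^sup>2 * (fact (j+2) * exp y) * exp (- y) = fact (j+2) * x\<^sup>2"
    by (simp add: exp_minus del: fact_Suc)
  ultimately have "y ^ j * exp (- y) \<le> fact (j+2) * x\<^sup>2" by (simp only:)
  then show ?thesis using True y by (simp add: flat_pow_def del: fact_Suc)
qed (simp add: flat_pow_def)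

lemma flat_pow_derivative:
  "(flat_pow j has_real_derivative flat_pow (j + 2) x - real j * flat_pow (j + 1) x) (at x)"
proof -
  consider "x > 0" | "x < 0" | "x = 0" by linarith
  then show ?thesis
  proof cases
    case 1
    have "((\<lambda>x. inverse x ^ j * exp (- inverse x)) has_real_derivative
        flat_pow (j + 2) x - real j * flat_pow (j + 1) x) (at x)"
    proof -
      have d: "(inverse has_real_derivative - (inverse x)\<^sup>2) (at x)"
        using DERIV_inverse[of x UNIV] 1 by (simp add: numeral_2_eq_2)
      have e: "((\<lambda>x. exp (- inverse x)) has_real_derivative exp (- inverse x) * (inverse x)\<^sup>2) (at x)"
        using DERIV_fun_exp[OF DERIV_minus[OF d]] by simp
      show ?thesis
        by (rule DERIV_cong[OF DERIV_mult[OF DERIV_power[OF d, of j] e]])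
          (use 1 in \<open>cases j; simp add: flat_pow_def power2_eq_square algebra_simps\<close>)
    qed
    then show ?thesis
      by (rule has_field_derivative_transform_within_open[where S = "{0<..}"])
        (use 1 in \<open>auto simp: flat_pow_def\<close>)
  next
    case 2
    have "((\<lambda>x. 0) has_real_derivative 0) (at x)" by simp
    then have "(flat_pow j has_real_derivative 0) (at x)"
      by (rule has_field_derivative_transform_within_open[where S = "{..<0}"])
        (use 2 in \<open>auto simp: flat_pow_def\<close>)
    then show ?thesis using 2 by (simp add: flat_pow_def)
  next
    case 3
    have "(flat_pow j has_real_derivative 0) (at 0)"
      unfolding has_field_derivative_iff
    proof (rule Lim_null_comparison)
      have *: "norm ((flat_pow j y - flat_pow j 0) / (y - 0)) \<le> fact (j + 2) * \<bar>y\<bar>" for y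
      proof (cases "y = 0")
        case False
        then show ?thesis
          using flat_pow_le_square[of j y]
          by (simp add: flat_pow_def[of j 0] abs_divide divide_le_eq power2_eq_square mult.assoc
              del: fact_Suc)
      qed simp
      show "\<forall>\<^sub>F y in at 0. norm ((flat_pow j y - flat_pow j 0) / (y - 0)) \<le> fact (j + 2) * \<bar>y\<bar>"
        using * by (intro always_eventually) blast
      show "((\<lambda>y. fact (j + 2) * \<bar>y::real\<bar>) \<longlongrightarrow> 0) (at 0)"
        by (rule tendsto_eq_intros refl | simp)+
    qed
    then show ?thesis using 3 by (simp add: flat_pow_def)
  qed
qed

text \<open>The derivative of a member of the family is a linear combination of members, so the
  induction on the order of differentiability runs with \<open>j\<close> arbitrary.\<close>

lemma smooth_flat_pow: "smooth (flat_pow j)"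
proof -
  have "C_class k (flat_pow j)" for k
  proof (induction k arbitrary: j)
    case 0
    show ?case
      using DERIV_isCont[OF flat_pow_derivative] by (simp add: continuous_at_imp_continuous_on)
  next
    case (Suc k)
    have "C_class k (\<lambda>x. flat_pow (j + 2) x + (- real j) * flat_pow (j + 1) x)"
      by (intro C_class_add C_class_mult C_class_const Suc)
    then show ?case
      by (intro C_class_real_SucI[OF flat_pow_derivative]) simp
  qed
  then show ?thesis by (simp add: smooth_def)
qed

definition flat :: "real \<Rightarrow> real" where
  "flat x = (if x > 0 then exp (- inverse x) else 0)"

lemma smooth_flat: "smooth flat"
proof -
  have "flat = flat_pow 0" by (auto simp: flat_def flat_pow_def)
  then show ?thesis using smooth_flat_pow[of 0] by (simp only:)
qed

lemma flat_pos: "x > 0 \<Longrightarrow> flat x > 0" and flat_nonpos: "x \<le> 0 \<Longrightarrow> flat x = 0"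
  and flat_nonneg: "flat x \<ge> 0"
  by (auto simp: flat_def)

lemma flat_mono: "x \<le> y \<Longrightarrow> flat x \<le> flat y"
  by (auto simp: flat_def le_imp_inverse_le)

text \<open>For \<open>x \<ge> 1\<close> the inner quotient is at least 1, so the outer
  \<open>flat\<close> vanishes; for \<open>x \<le> 0\<close> its argument is 1. Composing
  \<open>flat\<close> with itself needs division by the constant \<open>flat 1\<close> only, and
  monotonicity is inherited from \<open>flat\<close>.\<close>

definition smooth_step :: "real \<Rightarrow> real" where
  "smooth_step x = 1 - flat (1 - flat x / flat 1) / flat 1"

lemma smooth_smooth_step: "smooth smooth_step"
proof -
  have "smooth (\<lambda>x. 1 - inverse (flat 1) * flat (1 - inverse (flat 1) * flat x))"
    by (intro smooth_diff smooth_mult smooth_compose[OF smooth_flat] smooth_const smooth_flat)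
  then show ?thesis by (simp add: smooth_step_def[abs_def] divide_inverse mult.commute)
qed

lemma smooth_step_0: "x \<le> 0 \<Longrightarrow> smooth_step x = 0"
  using flat_pos[of 1] by (simp add: smooth_step_def flat_nonpos)

lemma smooth_step_1: "x \<ge> 1 \<Longrightarrow> smooth_step x = 1"
  using flat_pos[of 1] flat_mono[of 1 x] by (simp add: smooth_step_def flat_nonpos)

lemma smooth_step_mono: "x \<le> y \<Longrightarrow> smooth_step x \<le> smooth_step y"
  unfolding smooth_step_def
  using flat_pos[of 1]
  by (intro diff_left_mono divide_right_mono flat_mono) (auto intro: flat_mono)

lemma smooth_step_range: "0 \<le> smooth_step x" "smooth_step x \<le> 1"
  using smooth_step_mono[of "min x 0" x] smooth_step_mono[of x "max x 1"]
  by (auto simp: smooth_step_0 smooth_step_1)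

section \<open>Curves with bounded weak derivative\<close>

lemma smooth_affine: "smooth (\<lambda>r::real. (r - c) / d)"
proof -
  have "smooth (\<lambda>r::real. (1 / d) * r + (- c / d))"
    by (intro smooth_add smooth_mult smooth_const smooth_linear bounded_linear_ident)
  then show ?thesis by (simp add: diff_divide_distrib)
qed

definition ramp :: "real \<Rightarrow> real \<Rightarrow> real \<Rightarrow> real" where
  "ramp c d r = smooth_step ((r - c) / d)"

lemma smooth_ramp: "smooth (ramp c d)"
  unfolding ramp_def by (intro smooth_compose[OF smooth_smooth_step] smooth_affine)

lemma ramp_0: "0 < d \<Longrightarrow> r \<le> c \<Longrightarrow> ramp c d r = 0"
  by (auto simp: ramp_def intro!: smooth_step_0 divide_nonpos_pos)

lemma ramp_1: "0 < d \<Longrightarrow> r \<ge> c + d \<Longrightarrow> ramp c d r = 1"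
  by (auto simp: ramp_def le_divide_eq intro!: smooth_step_1)

lemma ramp_range: "0 \<le> ramp c d r" "ramp c d r \<le> 1"
  by (auto simp: ramp_def smooth_step_range)

lemma deriv_ramp_nonneg:
  assumes "0 < d"
  shows "0 \<le> deriv (ramp c d) r"
proof -
  have "mono (ramp c d)"
    using assms by (auto simp: mono_def ramp_def intro!: smooth_step_mono divide_right_mono)
  then show ?thesis
    using mono_on_imp_deriv_nonneg[of UNIV "ramp c d" "deriv (ramp c d) r" r]
      smooth_real_derivative(1)[OF smooth_ramp] by simp
qed

lemma deriv_ramp_0:
  assumes "0 < d" "r < c \<or> r > c + d"
  shows "deriv (ramp c d) r = 0"
  using assms(2)
proof
  assume r: "r < c"
  have "((\<lambda>r. 0) has_real_derivative 0) (at r)" by simp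
  then have "(ramp c d has_real_derivative 0) (at r)"
    by (rule has_field_derivative_transform_within_open[of _ _ _ "{..<c}"])
      (use r in \<open>auto simp: ramp_0 assms(1)\<close>)
  then show ?thesis by (rule DERIV_imp_deriv)
next
  assume r: "r > c + d"
  have "((\<lambda>r. 1) has_real_derivative 0) (at r)" by simp
  then have "(ramp c d has_real_derivative 0) (at r)"
    by (rule has_field_derivative_transform_within_open[of _ _ _ "{c+d<..}"])
      (use r in \<open>auto simp: ramp_1 assms(1)\<close>)
  then show ?thesis by (rule DERIV_imp_deriv)
qed

lemma lint_deriv_smooth:
  assumes "smooth A" "a \<le> (b::real)"
  shows "integrable (lebesgue_on {a..b}) (deriv A)"
    and "(LINT r|lebesgue_on {a..b}. deriv A r) = A b - A a"
proof -
  show int: "integrable (lebesgue_on {a..b}) (deriv A)"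
    using continuous_on_subset[OF smooth_real_derivative(2)[OF assms(1)]]
    by (intro continuous_imp_integrable_real) auto
  have "(deriv A has_integral (A b - A a)) {a..b}"
    using smooth_real_derivative(1)[OF assms(1)]
    by (intro fundamental_theorem_of_calculus assms(2))
      (auto simp flip: has_real_derivative_iff_has_vector_derivative intro: DERIV_subset)
  then show "(LINT r|lebesgue_on {a..b}. deriv A r) = A b - A a"
    by (simp add: lebesgue_integral_eq_integral[OF int] integral_unique)
qed

lemma bounded_measurable_integrable_on_interval:
  fixes g :: "real \<Rightarrow> 'a::euclidean_space"
  assumes "g \<in> borel_measurable (lebesgue_on {a..b})"
    and "AE r in lebesgue_on {a..b}. norm (g r) \<le> C"
  shows "integrable (lebesgue_on {a..b}) g"
proof -
  interpret finite_measure "lebesgue_on {a..b}"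
    by (intro finite_measure_lebesgue_on) auto
  show ?thesis using assms by (intro integrable_const_bound[where B = C])
qed

text \<open>The weak derivative is tested with a plateau \<open>\<phi>\<close> that rises just after
  \<open>s\<close> and falls just before \<open>s'\<close>. Then \<open>- deriv \<phi>\<close> acts
  almost like the difference of point masses at \<open>s'\<close> and \<open>s\<close>, while the
  integral of \<open>\<phi>\<close> against \<open>g\<close> is at most \<open>M * (s' - s)\<close>.
  Continuity at the two ends costs \<open>\<omega>\<close> each.\<close>

lemma W1_inf_curve_norm_diff_le_add:
  fixes \<gamma> :: "real \<Rightarrow> real ^ 'n"
  assumes W: "W1_inf_curve t \<gamma> g" and s: "0 < s" "s < s'" "s' < t" and M: "0 \<le> M"
    and bound: "AE r in lebesgue_on {0..t}. r \<in> {s..s'} \<longrightarrow> norm (g r) \<le> M"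
    and "\<omega> > 0"
  shows "norm (\<gamma> s' - \<gamma> s) \<le> M * (s' - s) + 2 * \<omega>"
proof -
  let ?L = "lebesgue_on {0..t}"
  \<comment> \<open>Projecting to the direction of the increment reduces the claim to a real
    function \<open>f\<close> whose increment is exactly the norm.\<close>
  define e where "e = sgn (\<gamma> s' - \<gamma> s)"
  have e: "norm e \<le> 1" by (simp add: e_def norm_sgn)
  define f where "f r = \<gamma> r \<bullet> e" for r
  have fdiff: "f s' - f s = norm (\<gamma> s' - \<gamma> s)"
    unfolding f_def e_def sgn_div_norm inner_diff_left[symmetric]
    by (cases "\<gamma> s' = \<gamma> s") (simp_all add: dot_square_norm power2_eq_square)
  have fle: "\<bar>f r - f r'\<bar> \<le> norm (\<gamma> r - \<gamma> r')" for r r'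
    using Cauchy_Schwarz_ineq2[of "\<gamma> r - \<gamma> r'" e] e mult_left_le[OF e, of "norm (\<gamma> r - \<gamma> r')"]
    by (simp add: f_def inner_diff_left)
  have cont: "continuous_on {0..t} \<gamma>" and meas: "g \<in> borel_measurable ?L"
    and weak: "\<And>\<phi>. test_function t \<phi> \<Longrightarrow>
        (LINT s|?L. deriv \<phi> s *\<^sub>R \<gamma> s) = - (LINT s|?L. \<phi> s *\<^sub>R g s)"
    using W by (auto simp: W1_inf_curve_def)
  obtain C where C: "AE s in ?L. norm (g s) \<le> C"
    using W by (auto simp: W1_inf_curve_def)
  have contf: "continuous_on {0..t} f"
    unfolding f_def by (intro continuous_intros cont)
  have ig: "integrable ?L g"
    using bounded_measurable_integrable_on_interval[OF meas C] .
  obtain d1 where d1: "d1 > 0" "\<And>r. r \<in> {0..t} \<Longrightarrow> dist r s < d1 \<Longrightarrow> dist (f r) (f s) < \<omega>"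
    using contf[unfolded continuous_on_iff, rule_format, of s, OF _ \<open>\<omega> > 0\<close>] s
    by (auto simp: Ball_def)
  obtain d2 where d2: "d2 > 0" "\<And>r. r \<in> {0..t} \<Longrightarrow> dist r s' < d2 \<Longrightarrow> dist (f r) (f s') < \<omega>"
    using contf[unfolded continuous_on_iff, rule_format, of s', OF _ \<open>\<omega> > 0\<close>] s
    by (auto simp: Ball_def)
  \<comment> \<open>With this width the two ramps do not overlap, and \<open>f\<close> varies by
    less than \<open>\<omega>\<close> on each of them.\<close>
  define d where "d = min ((s' - s) / 2) (min (d1 / 2) (d2 / 2))"
  have d: "0 < d" "2 * d \<le> s' - s" "d < d1" "d < d2"
    using d1(1) d2(1) s by (auto simp: d_def min_def)
  define A where "A = ramp s d"
  define B where "B = ramp (s' - d) d"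
  note A = smooth_ramp[of s d, folded A_def] ramp_0[OF d(1), of _ s, folded A_def]
    ramp_1[OF d(1), of s, folded A_def] ramp_range[of s d, folded A_def]
    deriv_ramp_nonneg[OF d(1), of s, folded A_def] deriv_ramp_0[OF d(1), of _ s, folded A_def]
  note B = smooth_ramp[of "s' - d" d, folded B_def] ramp_0[OF d(1), of _ "s' - d", folded B_def]
    ramp_1[OF d(1), of "s' - d", folded B_def] ramp_range[of "s' - d" d, folded B_def]
    deriv_ramp_nonneg[OF d(1), of "s' - d", folded B_def] deriv_ramp_0[OF d(1), of _ "s' - d", folded B_def]
  define \<phi> where "\<phi> r = A r - B r" for r
  have \<phi>01: "0 \<le> \<phi> r \<and> \<phi> r \<le> 1" for r
  proof (cases "r \<le> s' - d")
    case True
    then show ?thesis using A(4,5) B(2) by (simp add: \<phi>_def)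
  next
    case False
    then show ?thesis using A(3)[of r] B(4,5) d by (simp add: \<phi>_def)
  qed
  have \<phi>0: "\<phi> r = 0" if "r \<notin> {s..s'}" for r
    using that A(2,3)[of r] B(2,3)[of r] d by (auto simp: \<phi>_def)
  have sm: "smooth \<phi>" unfolding \<phi>_def by (intro smooth_diff A B)
  have "closure {r. \<phi> r \<noteq> 0} \<subseteq> {s..s'}"
    using \<phi>0 by (intro closure_minimal) blast+
  then have test: "test_function t \<phi>"
    using s sm by (auto simp: test_function_def)
  have d\<phi>: "deriv \<phi> r = deriv A r - deriv B r" for r
    unfolding \<phi>_def
    by (intro DERIV_imp_deriv DERIV_diff smooth_real_derivative A B)
  have intd: "integrable ?L (\<lambda>r. deriv \<phi> r *\<^sub>R \<gamma> r)"
    using smooth_real_derivative(2)[OF sm]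
    by (intro continuous_imp_integrable_real continuous_on_scaleR cont) (rule continuous_on_subset, auto)
  have \<phi>meas: "\<phi> \<in> borel_measurable ?L"
    using smooth_continuous[OF sm]
    by (intro continuous_imp_measurable_on_sets_lebesgue) (rule continuous_on_subset, auto)
  have int\<phi>g: "integrable ?L (\<lambda>r. \<phi> r *\<^sub>R g r)"
  proof (rule Bochner_Integration.integrable_bound[OF integrable_norm[OF ig]])
    show "(\<lambda>r. \<phi> r *\<^sub>R g r) \<in> borel_measurable ?L"
      using \<phi>meas meas by (rule borel_measurable_scaleR)
    have "\<bar>\<phi> r\<bar> * norm (g r) \<le> norm (g r)" for r
      using \<phi>01[of r] by (intro mult_left_le_one_le) auto
    then show "AE r in ?L. norm (\<phi> r *\<^sub>R g r) \<le> norm (norm (g r))"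
      by simp
  qed
  have "(LINT r|?L. deriv \<phi> r * f r) = (LINT r|?L. deriv \<phi> r *\<^sub>R \<gamma> r) \<bullet> e"
    using integral_inner_left[of e ?L "\<lambda>r. deriv \<phi> r *\<^sub>R \<gamma> r"] intd by (simp add: f_def)
  also have "\<dots> = - (LINT r|?L. (\<phi> r *\<^sub>R g r) \<bullet> e)"
    using weak[OF test] integral_inner_left[of e ?L "\<lambda>r. \<phi> r *\<^sub>R g r"] int\<phi>g by simp
  finally have 1: "(LINT r|?L. (\<phi> r *\<^sub>R g r) \<bullet> e) = - (LINT r|?L. deriv \<phi> r * f r)"
    by simp
  have 2: "(LINT r|?L. (\<phi> r *\<^sub>R g r) \<bullet> e) \<le> (LINT r|?L. M * indicator {s..s'} r)"
  proof (rule integral_mono_AE)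
    show "integrable ?L (\<lambda>r. (\<phi> r *\<^sub>R g r) \<bullet> e)"
      using int\<phi>g by (rule integrable_inner_left)
    have "{s..s'} \<in> sets ?L" using s by (simp add: sets_restrict_space_iff)
    then have "(\<lambda>r. M * indicator {s..s'} r) \<in> borel_measurable ?L"
      by (intro borel_measurable_times borel_measurable_const borel_measurable_indicator)
    then show "integrable ?L (\<lambda>r. M * indicator {s..s'} r)"
      by (rule bounded_measurable_integrable_on_interval[where C = M])
        (auto simp: indicator_def M)
    show "AE r in ?L. (\<phi> r *\<^sub>R g r) \<bullet> e \<le> M * indicator {s..s'} r"
      using bound
    proof eventually_elim
      case (elim r)
      show ?case
      proof (cases "r \<in> {s..s'}")
        case True
        have "g r \<bullet> e \<le> norm (g r) * norm e" by (rule norm_cauchy_schwarz)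
        also have "\<dots> \<le> M * 1" using elim True e M by (intro mult_mono) auto
        finally have "\<phi> r * (g r \<bullet> e) \<le> \<phi> r * M"
          using \<phi>01 by (intro mult_left_mono) auto
        also have "\<dots> \<le> 1 * M" using \<phi>01 M by (intro mult_right_mono) auto
        finally show ?thesis using True by simp
      qed (simp add: \<phi>0)
    qed
  qed
  have "measure ?L {s..s'} = s' - s"
    using s by (subst measure_restrict_space) auto
  then have 3: "(LINT r|?L. M * indicator {s..s'} r) = M * (s' - s)"
    using s by (simp add: min_def max_def)
  \<comment> \<open>The ramp derivatives are nonnegative and live near \<open>s\<close> and
    \<open>s'\<close>, so \<open>f\<close> may be replaced by its end values up to
    \<open>\<omega>\<close>; each derivative then integrates to 1.\<close>
  have "(LINT r|?L. deriv \<phi> r * f r) \<le> (LINT r|?L. deriv A r * (f s + \<omega>) - deriv B r * (f s' - \<omega>))"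
  proof (rule integral_mono)
    show "integrable ?L (\<lambda>r. deriv \<phi> r * f r)"
      using integrable_inner_left[of e ?L "\<lambda>r. deriv \<phi> r *\<^sub>R \<gamma> r"] intd by (simp add: f_def)
    show "integrable ?L (\<lambda>r. deriv A r * (f s + \<omega>) - deriv B r * (f s' - \<omega>))"
      using lint_deriv_smooth(1)[OF A(1)] lint_deriv_smooth(1)[OF B(1)] s by simp
    fix r assume "r \<in> space ?L"
    then have r: "r \<in> {0..t}" by simp
    have "deriv A r * f r \<le> deriv A r * (f s + \<omega>)"
    proof (cases "r < s \<or> r > s + d")
      case False
      then have "dist (f r) (f s) < \<omega>" using d by (intro d1 r) (auto simp: dist_real_def)
      then show ?thesis using A(6) by (intro mult_left_mono) (auto simp: dist_real_def)
    qed (simp add: A(7))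
    moreover have "deriv B r * (f s' - \<omega>) \<le> deriv B r * f r"
    proof (cases "r < s' - d \<or> r > s' - d + d")
      case False
      then have "dist (f r) (f s') < \<omega>" using d by (intro d2 r) (auto simp: dist_real_def)
      then show ?thesis using B(6) by (intro mult_left_mono) (auto simp: dist_real_def)
    qed (simp add: B(7))
    ultimately show "deriv \<phi> r * f r \<le> deriv A r * (f s + \<omega>) - deriv B r * (f s' - \<omega>)"
      by (simp add: d\<phi> left_diff_distrib)
  qed
  also have "\<dots> = (f s + \<omega>) - (f s' - \<omega>)"
    using lint_deriv_smooth[OF A(1), of 0 t] lint_deriv_smooth[OF B(1), of 0 t] s A(2)[of 0] A(3)[of t]
      B(2)[of 0] B(3)[of t] d by simp
  finally show ?thesis using 1 2 3 fdiff by linarith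
qed

lemma W1_inf_curve_norm_diff_le:
  fixes \<gamma> :: "real \<Rightarrow> real ^ 'n"
  assumes "W1_inf_curve t \<gamma> g" and "0 < s" "s < s'" "s' < t" and "0 \<le> M"
    and "AE r in lebesgue_on {0..t}. r \<in> {s..s'} \<longrightarrow> norm (g r) \<le> M"
  shows "norm (\<gamma> s' - \<gamma> s) \<le> M * (s' - s)"
proof (rule field_le_epsilon)
  fix \<omega> :: real assume "\<omega> > 0"
  then show "norm (\<gamma> s' - \<gamma> s) \<le> M * (s' - s) + \<omega>"
    using W1_inf_curve_norm_diff_le_add[OF assms, of "\<omega> / 2"] by simp
qed

section \<open>From local slopes to growth along curves\<close>

text \<open>Real induction: the set where the bound from \<open>a\<close> holds is compact and has a
  largest element \<open>c\<close>. If \<open>c < b\<close>, the local bound at \<open>c\<close>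
  yields a larger element.\<close>

lemma slope_bound_from_closed_right_slopes:
  fixes f :: "real \<Rightarrow> real"
  assumes "a \<le> b" and cont: "continuous_on {a..b} f"
    and slope: "\<And>s. a \<le> s \<Longrightarrow> s < b \<Longrightarrow>
      \<exists>d>0. \<forall>s'. s < s' \<and> s' < s + d \<and> s' < b \<longrightarrow> f s' - f s \<le> L * (s' - s)"
  shows "f b - f a \<le> L * (b - a)"
proof (rule ccontr)
  define h where "h r = f r - f a - L * (r - a)" for r
  assume neg: "\<not> f b - f a \<le> L * (b - a)"
  have conth: "continuous_on {a..b} h"
    unfolding h_def by (intro continuous_intros cont)
  have "closed ({a..b} \<inter> h -` {..0})"
    by (rule continuous_closed_preimage[OF conth]) auto
  then have "compact ({a..b} \<inter> h -` {..0})"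
    using compact_Int_closed[of "{a..b}" "{a..b} \<inter> h -` {..0}"] by (simp add: Int_absorb1)
  moreover have "a \<in> {a..b} \<inter> h -` {..0}" using assms(1) by (simp add: h_def)
  ultimately obtain c where c: "c \<in> {a..b} \<inter> h -` {..0}"
    and cmax: "\<And>r. r \<in> {a..b} \<inter> h -` {..0} \<Longrightarrow> r \<le> c"
    using compact_attains_sup by (metis empty_iff)
  have "c < b" using c neg by (cases "c = b") (auto simp: h_def)
  then obtain d where d: "d > 0"
    "\<And>s'. c < s' \<Longrightarrow> s' < c + d \<Longrightarrow> s' < b \<Longrightarrow> f s' - f c \<le> L * (s' - c)"
    using slope[of c] c by auto
  define s' where "s' = (c + min (c + d) b) / 2"
  have s': "c < s'" "s' < c + d" "s' < b"
    using \<open>c < b\<close> d(1) by (auto simp: s'_def min_def)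
  have "h s' \<le> h c"
    using d(2)[OF s'] by (simp add: h_def algebra_simps)
  then have "s' \<in> {a..b} \<inter> h -` {..0}" using c s' by auto
  then show False using cmax[of s'] s' by auto
qed

text \<open>Version with slopes known at interior points only, as is the case for curves because
  test functions vanish near the ends. Starting slightly to the right of \<open>a\<close> costs an
  arbitrarily small error by continuity.\<close>

lemma slope_bound_from_right_slopes:
  fixes f :: "real \<Rightarrow> real"
  assumes "a < b" and cont: "continuous_on {a..b} f" and "L \<ge> 0"
    and slope: "\<And>s. a < s \<Longrightarrow> s < b \<Longrightarrow>
      \<exists>d>0. \<forall>s'. s < s' \<and> s' < s + d \<and> s' < b \<longrightarrow> f s' - f s \<le> L * (s' - s)"
  shows "f b - f a \<le> L * (b - a)"
proof (rule field_le_epsilon)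
  fix e :: real assume "e > 0"
  then obtain d where d: "d > 0" "\<And>r. r \<in> {a..b} \<Longrightarrow> dist r a < d \<Longrightarrow> dist (f r) (f a) < e"
    using cont[unfolded continuous_on_iff, rule_format, of a e] assms(1)
    by (auto simp: Ball_def)
  define a' where "a' = a + min (d / 2) ((b - a) / 2)"
  have a': "a < a'" "a' < b" "a' < a + d"
    using d(1) assms(1) by (auto simp: a'_def min_def field_simps)
  have "f b - f a' \<le> L * (b - a')"
    using a' by (intro slope_bound_from_closed_right_slopes slope continuous_on_subset[OF cont]) auto
  also have "\<dots> \<le> L * (b - a)"
    using a' \<open>L \<ge> 0\<close> by (intro mult_left_mono) auto
  finally have "f b - f a' \<le> L * (b - a)" .
  moreover have "dist (f a') (f a) < e"
    using a' by (intro d(2)) (auto simp: dist_real_def)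
  ultimately show "f b - f a \<le> L * (b - a) + e"
    by (auto simp: dist_real_def)
qed

text \<open>In effect \<open>a * \<bar>Du\<bar> \<le> 1\<close>, stated by local slopes since
  \<open>u\<close> need not be differentiable. Near \<open>\<gamma> s\<close> the speed is below
  \<open>(1 + \<eta>) * a (\<gamma> s)\<close> by continuity of \<open>a\<close>, so
  \<open>u\<close> grows along the curve at rate at most \<open>1 + \<eta>\<close>; then
  \<open>\<eta>\<close> tends to 0.\<close>

lemma reachable_set_potential_le:
  fixes a u :: "real ^ 'n \<Rightarrow> real"
  assumes conta: "continuous_on UNIV a" and pos: "\<And>x. 0 < a x"
    and contu: "continuous_on UNIV u"
    and slope: "\<And>x. \<exists>L\<ge>0. L * a x \<le> 1 \<and> (\<forall>\<^sub>F y in nhds x. \<bar>u y - u x\<bar> \<le> L * norm (y - x))"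
    and "t > 0" and y: "y \<in> reachable_set a t x"
  shows "u y - u x \<le> t"
proof -
  obtain \<gamma> g where W: "W1_inf_curve t \<gamma> g" and ends: "\<gamma> 0 = x" "\<gamma> t = y"
    and speed: "AE s in lebesgue_on {0..t}. norm (g s) \<le> a (\<gamma> s)"
    using y by (auto simp: reachable_set_def)
  have cont\<gamma>: "continuous_on {0..t} \<gamma>" using W by (simp add: W1_inf_curve_def)
  have bound: "u (\<gamma> t) - u (\<gamma> 0) \<le> (1 + \<eta>) * (t - 0)" if "\<eta> > 0" for \<eta>
  proof (rule slope_bound_from_right_slopes)
    show "continuous_on {0..t} (\<lambda>s. u (\<gamma> s))"
      by (rule continuous_on_compose2[OF contu cont\<gamma>]) auto
    fix s assume s: "0 < s" "s < t"
    obtain L where L: "L \<ge> 0" "L * a (\<gamma> s) \<le> 1"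
      and Lev: "\<forall>\<^sub>F y in nhds (\<gamma> s). \<bar>u y - u (\<gamma> s)\<bar> \<le> L * norm (y - \<gamma> s)"
      using slope by blast
    have "a (\<gamma> s) < (1 + \<eta>) * a (\<gamma> s)" using pos that by simp
    then have "\<forall>\<^sub>F y in nhds (\<gamma> s). a y < (1 + \<eta>) * a (\<gamma> s)"
      using conta by (intro order_tendstoD(2)[of a "a (\<gamma> s)"])
        (auto simp: continuous_on_eq_continuous_at isCont_def tendsto_nhds_iff)
    with Lev have "\<forall>\<^sub>F y in nhds (\<gamma> s). \<bar>u y - u (\<gamma> s)\<bar> \<le> L * norm (y - \<gamma> s) \<and> a y < (1 + \<eta>) * a (\<gamma> s)"
      by (rule eventually_conj)
    then obtain e where e: "e > 0" "\<And>y. dist y (\<gamma> s) < e \<Longrightarrow>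
        \<bar>u y - u (\<gamma> s)\<bar> \<le> L * norm (y - \<gamma> s) \<and> a y < (1 + \<eta>) * a (\<gamma> s)"
      unfolding eventually_nhds_metric by blast
    obtain d where d: "d > 0" "\<And>r. r \<in> {0..t} \<Longrightarrow> dist r s < d \<Longrightarrow> dist (\<gamma> r) (\<gamma> s) < e"
      using cont\<gamma>[unfolded continuous_on_iff, rule_format, of s e] s e(1)
      by (auto simp: Ball_def)
    have "u (\<gamma> s') - u (\<gamma> s) \<le> (1 + \<eta>) * (s' - s)" if s': "s < s'" "s' < s + d" "s' < t" for s'
    proof -
      have near: "dist (\<gamma> r) (\<gamma> s) < e" if "r \<in> {s..s'}" for r
        using that s s' by (intro d(2)) (auto simp: dist_real_def)
      have "AE r in lebesgue_on {0..t}. r \<in> {s..s'} \<longrightarrow> norm (g r) \<le> (1 + \<eta>) * a (\<gamma> s)"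
        using speed by eventually_elim (use e(2) near in force)
      then have "norm (\<gamma> s' - \<gamma> s) \<le> (1 + \<eta>) * a (\<gamma> s) * (s' - s)"
        using s s' pos[of "\<gamma> s"] \<open>\<eta> > 0\<close> by (intro W1_inf_curve_norm_diff_le[OF W]) auto
      then have "L * norm (\<gamma> s' - \<gamma> s) \<le> L * ((1 + \<eta>) * a (\<gamma> s) * (s' - s))"
        using L(1) by (rule mult_left_mono)
      also have "\<dots> = (L * a (\<gamma> s)) * ((1 + \<eta>) * (s' - s))" by (simp add: mult_ac)
      also have "\<dots> \<le> 1 * ((1 + \<eta>) * (s' - s))"
        using L(2) \<open>\<eta> > 0\<close> s' by (intro mult_right_mono) auto
      finally show ?thesis using e(2)[OF near[of s']] s' by auto
    qed
    then show "\<exists>d>0. \<forall>s'. s < s' \<and> s' < s + d \<and> s' < t \<longrightarrow>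
        u (\<gamma> s') - u (\<gamma> s) \<le> (1 + \<eta>) * (s' - s)"
      using d(1) by blast
  qed (use \<open>t > 0\<close> \<open>\<eta> > 0\<close> in auto)
  show ?thesis
  proof (rule field_le_epsilon)
    fix e :: real assume "e > 0"
    have "(1 + e / t) * (t - 0) = t + e" using \<open>t > 0\<close> by (simp add: field_simps)
    then show "u y - u x \<le> t + e"
      using bound[of "e / t"] \<open>t > 0\<close> \<open>e > 0\<close> ends by simp
  qed
qed

text \<open>McShane's extension: \<open>u\<close> is the lower envelope of the cones of slope
  \<open>K\<close> standing on the graph of \<open>g\<close>.\<close>

lemma lipschitz_extension:
  fixes g :: "'a::metric_space \<Rightarrow> real"
  assumes "T \<noteq> {}" and g: "\<And>x y. x \<in> T \<Longrightarrow> y \<in> T \<Longrightarrow> g x - g y \<le> K * dist x y" and K: "K \<ge> 0"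
  obtains u where "\<And>x. x \<in> T \<Longrightarrow> u x = g x" "\<And>x y. \<bar>u x - u y\<bar> \<le> K * dist x y"
proof -
  define u where "u x = (INF y\<in>T. g y + K * dist x y)" for x
  obtain y0 where y0: "y0 \<in> T" using assms(1) by blast
  have bdd: "bdd_below ((\<lambda>y. g y + K * dist x y) ` T)" for x
  proof (rule bdd_belowI2)
    fix y assume "y \<in> T"
    then have "g y0 - g y \<le> K * dist y0 y" using g y0 by blast
    also have "\<dots> \<le> K * (dist x y0 + dist x y)"
      using dist_triangle3[of y0 y x] K by (intro mult_left_mono) auto
    finally show "g y0 - K * dist x y0 \<le> g y + K * dist x y"
      by (simp add: algebra_simps)
  qed
  have le: "u x - u y \<le> K * dist x y" for x y
  proof -
    have "u x - K * dist x y \<le> u y"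
      unfolding u_def[of y]
    proof (rule cINF_greatest[OF assms(1)])
      fix z assume "z \<in> T"
      then have "u x \<le> g z + K * dist x z" unfolding u_def by (rule cINF_lower[OF bdd])
      also have "\<dots> \<le> g z + K * (dist x y + dist y z)"
        using K by (intro add_left_mono mult_left_mono dist_triangle) auto
      finally show "u x - K * dist x y \<le> g z + K * dist y z" by (simp add: algebra_simps)
    qed
    then show ?thesis by simp
  qed
  show ?thesis
  proof
    fix x assume x: "x \<in> T"
    have "u x \<le> g x" using cINF_lower[OF bdd x, of x] by (simp add: u_def)
    moreover have "g x \<le> u x"
      unfolding u_def using g[OF x] by (intro cINF_greatest assms(1)) (simp add: algebra_simps)
    ultimately show "u x = g x" by simp
  next
    show "\<bar>u x - u y\<bar> \<le> K * dist x y" for x y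
      using le[of x y] le[of y x] by (simp add: dist_commute abs_le_iff)
  qed
qed

section \<open>Concatenation of curves\<close>

text \<open>Piecewise differentiable curves with an everywhere defined velocity \<open>g\<close>.
  Borel measurability and boundedness on the whole line survive time shifts and case distinctions,
  hence concatenation; the finite set holds the corners.\<close>

definition admissible ::
  "(real ^ 'n \<Rightarrow> real) \<Rightarrow> real \<Rightarrow> (real \<Rightarrow> real ^ 'n) \<Rightarrow> (real \<Rightarrow> real ^ 'n) \<Rightarrow> bool" where
  "admissible a t \<gamma> g \<longleftrightarrow>
     continuous_on {0..t} \<gamma> \<and> g \<in> borel_measurable borel \<and>
     (\<exists>C. \<forall>s. norm (g s) \<le> C) \<and>
     (\<exists>S. finite S \<and> (\<forall>s\<in>{0<..<t} - S. (\<gamma> has_vector_derivative g s) (at s))) \<and>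
     (\<forall>s\<in>{0..t}. norm (g s) \<le> a (\<gamma> s))"

text \<open>Integration by parts: \<open>\<phi> s *\<^sub>R \<gamma> s\<close> is continuous and
  differentiable off a finite set, and it vanishes at both ends.\<close>

lemma admissible_W1_inf_curve:
  fixes \<gamma> :: "real \<Rightarrow> real ^ 'n"
  assumes "admissible a t \<gamma> g" "0 \<le> t"
  shows "W1_inf_curve t \<gamma> g"
proof -
  let ?L = "lebesgue_on {0..t}"
  obtain C S where cont: "continuous_on {0..t} \<gamma>" and meas: "g \<in> borel_measurable borel"
    and C: "\<And>s. norm (g s) \<le> C" and S: "finite S"
    and D: "\<And>s. s \<in> {0<..<t} - S \<Longrightarrow> (\<gamma> has_vector_derivative g s) (at s)"
    using assms(1) unfolding admissible_def by blast
  have meas': "g \<in> borel_measurable ?L"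
    using meas by (intro measurable_restrict_space1 measurable_completion) simp
  have ig: "integrable ?L g"
    using C by (intro bounded_measurable_integrable_on_interval[OF meas', of C]) auto
  have "(LINT s|?L. deriv \<phi> s *\<^sub>R \<gamma> s) = - (LINT s|?L. \<phi> s *\<^sub>R g s)"
    if \<phi>: "test_function t \<phi>" for \<phi>
  proof -
    have sm: "smooth \<phi>" and supp: "closure {s. \<phi> s \<noteq> 0} \<subseteq> {0<..<t}"
      using \<phi> by (auto simp: test_function_def)
    have "{s. \<phi> s \<noteq> 0} \<subseteq> {0<..<t}" by (rule order_trans[OF closure_subset supp])
    then have ends: "\<phi> 0 = 0" "\<phi> t = 0" by auto
    have cont\<phi>: "continuous_on {0..t} \<phi>" "continuous_on {0..t} (deriv \<phi>)"
      by (rule continuous_on_subset[OF smooth_continuous[OF sm]], simp)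
        (rule continuous_on_subset[OF smooth_real_derivative(2)[OF sm]], simp)
    have i1: "integrable ?L (\<lambda>s. deriv \<phi> s *\<^sub>R \<gamma> s)"
      by (intro continuous_imp_integrable_real continuous_on_scaleR cont cont\<phi>)
    obtain B where B: "\<forall>x\<in>\<phi> ` {0..t}. norm x \<le> B"
      using compact_imp_bounded[OF compact_continuous_image[OF cont\<phi>(1)]] unfolding bounded_iff by blast
    have i2: "integrable ?L (\<lambda>s. \<phi> s *\<^sub>R g s)"
    proof (rule bounded_measurable_integrable_on_interval)
      show "(\<lambda>s. \<phi> s *\<^sub>R g s) \<in> borel_measurable ?L"
        using cont\<phi>(1) by (intro borel_measurable_scaleR meas' continuous_imp_measurable_on_sets_lebesgue) auto
      have "norm (\<phi> s *\<^sub>R g s) \<le> B * C" if "s \<in> {0..t}" for s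
      proof -
        have "norm (\<phi> s) \<le> B" using B that by blast
        then have "norm (\<phi> s) * norm (g s) \<le> B * C"
          using C[of s] norm_ge_zero[of "\<phi> s"] norm_ge_zero[of "g s"] by (intro mult_mono) linarith+
        then show ?thesis by simp
      qed
      then show "AE s in ?L. norm (\<phi> s *\<^sub>R g s) \<le> B * C"
        by (intro AE_I2) auto
    qed
    have "((\<lambda>s. \<phi> s *\<^sub>R g s + deriv \<phi> s *\<^sub>R \<gamma> s) has_integral (\<phi> t *\<^sub>R \<gamma> t - \<phi> 0 *\<^sub>R \<gamma> 0)) {0..t}"
    proof (rule fundamental_theorem_of_calculus_interior_strong[OF S assms(2)])
      fix s assume s: "s \<in> {0<..<t} - S"
      show "((\<lambda>s. \<phi> s *\<^sub>R \<gamma> s) has_vector_derivative \<phi> s *\<^sub>R g s + deriv \<phi> s *\<^sub>R \<gamma> s) (at s)"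
        by (rule has_vector_derivative_scaleR[OF smooth_real_derivative(1)[OF sm] D[OF s]])
    qed (intro continuous_on_scaleR cont cont\<phi>)
    then have "integral {0..t} (\<lambda>s. \<phi> s *\<^sub>R g s + deriv \<phi> s *\<^sub>R \<gamma> s) = 0"
      by (simp add: ends integral_unique)
    then have "(LINT s|?L. \<phi> s *\<^sub>R g s + deriv \<phi> s *\<^sub>R \<gamma> s) = 0"
      using i1 i2 by (subst lebesgue_integral_eq_integral) auto
    then show ?thesis
      using i1 i2 by (simp add: eq_neg_iff_add_eq_0 add.commute)
  qed
  moreover have "AE s in ?L. norm (g s) \<le> C" using C by simp
  ultimately show ?thesis
    using cont meas' by (auto simp: W1_inf_curve_def)
qed

definition joins :: "(real ^ 'n \<Rightarrow> real) \<Rightarrow> real \<Rightarrow> real ^ 'n \<Rightarrow> real ^ 'n \<Rightarrow> bool" where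
  "joins a t x y \<longleftrightarrow> 0 \<le> t \<and> (\<exists>\<gamma> g. admissible a t \<gamma> g \<and> \<gamma> 0 = x \<and> \<gamma> t = y)"

lemma joins_reachable: "joins a t x y \<Longrightarrow> y \<in> reachable_set a t x"
proof -
  assume "joins a t x y"
  then obtain \<gamma> g where *: "0 \<le> t" "admissible a t \<gamma> g" "\<gamma> 0 = x" "\<gamma> t = y"
    by (auto simp: joins_def)
  then have "\<forall>s\<in>{0..t}. norm (g s) \<le> a (\<gamma> s)" by (simp add: admissible_def)
  then have "AE s in lebesgue_on {0..t}. norm (g s) \<le> a (\<gamma> s)"
    by (intro AE_I2) auto
  with * show "y \<in> reachable_set a t x"
    using admissible_W1_inf_curve unfolding reachable_set_def by blast
qed

lemma joins_line:
  assumes "0 \<le> t" and "\<And>s. 0 \<le> s \<Longrightarrow> s \<le> t \<Longrightarrow> norm v \<le> a (x + s *\<^sub>R v)"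
  shows "joins a t x (x + t *\<^sub>R v)"
proof -
  have "((\<lambda>s. x + s *\<^sub>R v) has_vector_derivative v) (at s)" for s
    by (auto intro!: derivative_eq_intros)
  then have "admissible a t (\<lambda>s. x + s *\<^sub>R v) (\<lambda>s. v)"
    using assms(2) unfolding admissible_def
    by (auto intro!: continuous_intros exI[of _ "{} :: real set"])
  then show ?thesis
    using assms(1) unfolding joins_def by (intro conjI exI) auto
qed

text \<open>A segment shorter than \<open>m * t\<close> is traversed at reduced speed, so that the
  travel time is exactly \<open>t\<close>. This lets the times of a route add up exactly.\<close>

lemma joins_segment:
  assumes "0 < t" and "\<And>z. m \<le> a z" and "norm (y - x) \<le> m * t"
  shows "joins a t x y"
proof -
  have m: "norm ((y - x) /\<^sub>R t) \<le> m"
    using assms(1,3) by (simp add: divide_inverse_commute[symmetric] pos_divide_le_eq)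
  then have "joins a t x (x + t *\<^sub>R ((y - x) /\<^sub>R t))"
    using assms(1) order_trans[OF m assms(2)] by (intro joins_line) simp_all
  then show ?thesis using assms(1) by simp
qed

lemma joins_trans:
  fixes x y z :: "real ^ 'n"
  assumes "joins a t x y" "joins a t' y z"
  shows "joins a (t + t') x z"
proof -
  obtain \<gamma>1 g1 where t: "0 \<le> t" and 1: "admissible a t \<gamma>1 g1" and e1: "\<gamma>1 0 = x" "\<gamma>1 t = y"
    using assms(1) by (auto simp: joins_def)
  obtain \<gamma>2 g2 where t': "0 \<le> t'" and 2: "admissible a t' \<gamma>2 g2" and e2: "\<gamma>2 0 = y" "\<gamma>2 t' = z"
    using assms(2) by (auto simp: joins_def)
  obtain C1 S1 where c1: "continuous_on {0..t} \<gamma>1" and m1: "g1 \<in> borel_measurable borel"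
    and C1: "\<And>s. norm (g1 s) \<le> C1" and S1: "finite S1"
    and D1: "\<And>s. s \<in> {0<..<t} - S1 \<Longrightarrow> (\<gamma>1 has_vector_derivative g1 s) (at s)"
    and b1: "\<And>s. s \<in> {0..t} \<Longrightarrow> norm (g1 s) \<le> a (\<gamma>1 s)"
    using 1 unfolding admissible_def by blast
  obtain C2 S2 where c2: "continuous_on {0..t'} \<gamma>2" and m2: "g2 \<in> borel_measurable borel"
    and C2: "\<And>s. norm (g2 s) \<le> C2" and S2: "finite S2"
    and D2: "\<And>s. s \<in> {0<..<t'} - S2 \<Longrightarrow> (\<gamma>2 has_vector_derivative g2 s) (at s)"
    and b2: "\<And>s. s \<in> {0..t'} \<Longrightarrow> norm (g2 s) \<le> a (\<gamma>2 s)"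
    using 2 unfolding admissible_def by blast
  define \<gamma> where "\<gamma> s = (if s \<le> t then \<gamma>1 s else \<gamma>2 (s - t))" for s
  define g where "g s = (if s \<le> t then g1 s else g2 (s - t))" for s
  have "admissible a (t + t') \<gamma> g"
    unfolding admissible_def
  proof (intro conjI)
    have "continuous_on {t..t + t'} (\<lambda>s. \<gamma>2 (s - t))"
      by (rule continuous_on_compose2[OF c2]) (auto intro!: continuous_intros)
    then have "continuous_on ({0..t} \<union> {t..t + t'}) \<gamma>"
      unfolding \<gamma>_def using c1 e1 e2 by (intro continuous_on_cases) auto
    moreover have "{0..t} \<union> {t..t + t'} = {0..t + t'}" using t t' by auto
    ultimately show "continuous_on {0..t + t'} \<gamma>" by simp
    show "g \<in> borel_measurable borel"
      unfolding g_def using m1 m2 by measurable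
    have "norm (g s) \<le> max C1 C2" for s
      using C1[of s] C2[of "s - t"] by (auto simp: g_def)
    then show "\<exists>C. \<forall>s. norm (g s) \<le> C" by blast
    show "\<exists>S. finite S \<and> (\<forall>s\<in>{0<..<t + t'} - S. (\<gamma> has_vector_derivative g s) (at s))"
    proof (intro exI conjI ballI)
      \<comment> \<open>The junction time \<open>t\<close> becomes exceptional because the velocity
        may jump there.\<close>
      show "finite (S1 \<union> {t} \<union> (+) t ` S2)" using S1 S2 by simp
      fix s assume s: "s \<in> {0<..<t + t'} - (S1 \<union> {t} \<union> (+) t ` S2)"
      then consider "s < t" | "s > t" by fastforce
      then show "(\<gamma> has_vector_derivative g s) (at s)"
      proof cases
        case 1
        then have "(\<gamma>1 has_vector_derivative g1 s) (at s)" using s by (intro D1) auto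
        then have "(\<gamma> has_vector_derivative g1 s) (at s)"
          by (rule has_vector_derivative_transform_within_open[of _ _ _ "{..<t}"])
            (use 1 in \<open>auto simp: \<gamma>_def\<close>)
        then show ?thesis using 1 by (simp add: g_def)
      next
        case 2
        have "s - t \<notin> S2"
          using s image_eqI[of s "(+) t" "s - t" S2] by auto
        then have "(\<gamma>2 has_vector_derivative g2 (s - t)) (at (s - t))"
          using s 2 by (intro D2) auto
        moreover have "((\<lambda>s. s - t) has_vector_derivative 1) (at s)"
          by (auto intro!: derivative_eq_intros)
        ultimately have "((\<lambda>s. \<gamma>2 (s - t)) has_vector_derivative g2 (s - t)) (at s)"
          using vector_diff_chain_at[of "\<lambda>s. s - t" 1 s \<gamma>2 "g2 (s - t)"] by (simp add: o_def)
        then have "(\<gamma> has_vector_derivative g2 (s - t)) (at s)"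
          by (rule has_vector_derivative_transform_within_open[of _ _ _ "{t<..}"])
            (use 2 in \<open>auto simp: \<gamma>_def\<close>)
        then show ?thesis using 2 by (simp add: g_def)
      qed
    qed
    show "\<forall>s\<in>{0..t + t'}. norm (g s) \<le> a (\<gamma> s)"
      using b1 b2 by (auto simp: g_def \<gamma>_def)
  qed
  moreover have "\<gamma> 0 = x" "\<gamma> (t + t') = z"
    using t t' e1 e2 by (auto simp: \<gamma>_def)
  ultimately show ?thesis using t t' unfolding joins_def by (intro conjI exI[of _ \<gamma>] exI[of _ g]) auto
qed

section \<open>Tubes around closed geodesics\<close>

text \<open>
  For \<open>w $ i \<noteq> 0\<close> the kernel of \<open>transverse w i\<close> is the line spanned by \<open>w\<close>, and the map is integral
  when \<open>w\<close> is. Hence \<open>tube_fn w i c\<close> below is periodic and vanishes on a discrete family of lines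
  parallel to \<open>w\<close>; it serves as a smooth substitute for the squared distance to these lines.
\<close>

definition transverse :: "real ^ 'n \<Rightarrow> 'n \<Rightarrow> real ^ 'n \<Rightarrow> real ^ 'n" where
  "transverse w i v = (\<chi> b. w $ i * v $ b - w $ b * v $ i)"

lemma transverse_linear:
  "transverse w i (u + v) = transverse w i u + transverse w i v"
  "transverse w i (u - v) = transverse w i u - transverse w i v"
  "transverse w i (s *\<^sub>R v) = s *\<^sub>R transverse w i v"
  by (simp_all add: transverse_def vec_eq_iff algebra_simps)

lemma transverse_self: "transverse w i w = 0"
  by (simp add: transverse_def vec_eq_iff)

lemma transverse_bound: "\<bar>transverse w i v $ b\<bar> \<le> 2 * norm w * norm v"
proof -
  have "\<bar>transverse w i v $ b\<bar> \<le> \<bar>w $ i\<bar> * \<bar>v $ b\<bar> + \<bar>w $ b\<bar> * \<bar>v $ i\<bar>"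
    unfolding transverse_def by (simp flip: abs_mult)
  also have "\<dots> \<le> norm w * norm v + norm w * norm v"
    by (intro add_mono mult_mono component_le_norm_cart) auto
  finally show ?thesis by (simp add: mult_ac)
qed

lemma transverse_decomposition:
  assumes "w $ i \<noteq> 0"
  shows "v = (v $ i / w $ i) *\<^sub>R w + (1 / w $ i) *\<^sub>R transverse w i v"
  using assms by (simp add: transverse_def vec_eq_iff field_simps)

lemma transverse_integer:
  assumes "integer_vector w" "integer_vector z"
  shows "transverse w i z $ b \<in> \<int>"
  using assms by (simp add: transverse_def integer_vector_def)

definition tube_fn :: "real ^ 'n \<Rightarrow> 'n \<Rightarrow> real ^ 'n \<Rightarrow> real ^ 'n \<Rightarrow> real" where
  "tube_fn w i c x = (\<Sum>b\<in>UNIV. 1 - cos (2 * pi * transverse w i (x - c) $ b))"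

lemma smooth_tube_fn: "smooth (tube_fn w i c)"
proof -
  have lin: "smooth (\<lambda>x. transverse w i x $ b)" for b
    by (intro smooth_linear) (simp add: linear_conv_bounded_linear[symmetric] linear_iff transverse_linear)
  have "smooth (\<lambda>x. \<Sum>b\<in>UNIV. 1 - cos ((2 * pi) * (transverse w i x $ b - transverse w i c $ b)))"
    by (intro smooth_sum smooth_diff smooth_compose[OF smooth_cos] smooth_mult smooth_const lin)
  then show ?thesis by (simp add: tube_fn_def[abs_def] transverse_linear)
qed

lemma tube_fn_nonneg: "0 \<le> tube_fn w i c x"
  unfolding tube_fn_def by (intro sum_nonneg) simp

lemma tube_fn_term_le: "1 - cos (2 * pi * transverse w i (x - c) $ b) \<le> tube_fn w i c x"
  unfolding tube_fn_def by (rule member_le_sum) auto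

lemma tube_fn_base: "tube_fn w i c c = 0"
  by (simp add: tube_fn_def transverse_def)

lemma tube_fn_along: "tube_fn w i c (x + s *\<^sub>R w) = tube_fn w i c x"
  by (simp add: tube_fn_def transverse_linear transverse_self add_diff_eq[symmetric] diff_add_eq)

lemma cos_add_2pi_Ints: "k \<in> \<int> \<Longrightarrow> cos (2 * pi * (x + k)) = cos (2 * pi * x)"
proof -
  assume "k \<in> \<int>"
  then have "cos (2 * pi * k) = 1" "sin (2 * pi * k) = 0"
    by (auto elim!: Ints_cases simp: cos_int_2pin sin_int_2pin)
  then show ?thesis by (simp add: distrib_left cos_add)
qed

lemma tube_fn_periodic:
  fixes w :: "real ^ 'n"
  shows "integer_vector w \<Longrightarrow> torus_periodic (tube_fn w i c)"
  unfolding torus_periodic_def tube_fn_def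
proof (intro allI impI sum.cong refl)
  fix x z :: "real ^ 'n" and b assume "integer_vector w" "integer_vector z"
  moreover have "transverse w i (x + z - c) $ b = transverse w i (x - c) $ b + transverse w i z $ b"
    by (simp add: transverse_linear)
  ultimately show "1 - cos (2 * pi * transverse w i (x + z - c) $ b) =
      1 - cos (2 * pi * transverse w i (x - c) $ b)"
    by (simp add: cos_add_2pi_Ints transverse_integer)
qed

lemma abs_cos_diff_le: "\<bar>cos x - cos y\<bar> \<le> \<bar>x - y :: real\<bar>"
proof -
  have "norm (cos x - cos y) \<le> 1 * norm (x - y)"
    by (rule field_differentiable_bound[where S = UNIV and f' = "\<lambda>x. - sin x"])
      (auto intro!: derivative_eq_intros)
  then show ?thesis by simp
qed

text \<open>Turns a gap between values of tube functions into a distance between points, which keeps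
  tubes of different vertices apart.\<close>

lemma tube_fn_lipschitz:
  fixes w :: "real ^ 'n"
  shows "\<bar>tube_fn w i c x - tube_fn w i c y\<bar> \<le> real CARD('n) * (4 * pi * norm w) * norm (x - y)"
proof -
  have "\<bar>tube_fn w i c x - tube_fn w i c y\<bar> \<le>
      (\<Sum>b\<in>UNIV. \<bar>(1 - cos (2 * pi * transverse w i (x - c) $ b)) - (1 - cos (2 * pi * transverse w i (y - c) $ b))\<bar>)"
    unfolding tube_fn_def sum_subtractf[symmetric] by (rule sum_abs)
  also have "\<dots> \<le> (\<Sum>b\<in>(UNIV :: 'n set). 4 * pi * norm w * norm (x - y))"
  proof (rule sum_mono)
    fix b
    have "\<bar>(1 - cos (2 * pi * transverse w i (x - c) $ b)) - (1 - cos (2 * pi * transverse w i (y - c) $ b))\<bar>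
        \<le> \<bar>2 * pi * transverse w i (y - c) $ b - 2 * pi * transverse w i (x - c) $ b\<bar>"
      using abs_cos_diff_le[of "2 * pi * transverse w i (y - c) $ b" "2 * pi * transverse w i (x - c) $ b"]
      by simp
    also have "\<dots> = 2 * pi * \<bar>transverse w i (y - x) $ b\<bar>"
      by (simp add: transverse_linear abs_mult flip: right_diff_distrib)
    also have "\<dots> \<le> 2 * pi * (2 * norm w * norm (y - x))"
      by (intro mult_left_mono transverse_bound) auto
    finally show "\<bar>(1 - cos (2 * pi * transverse w i (x - c) $ b)) - (1 - cos (2 * pi * transverse w i (y - c) $ b))\<bar>
        \<le> 4 * pi * norm w * norm (x - y)"
      by (simp add: norm_minus_commute)
  qed
  finally show ?thesis by simp
qed

lemma tube_fn_eq_0_iff: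
  "tube_fn w i c x = 0 \<longleftrightarrow> (\<forall>b. transverse w i (x - c) $ b \<in> \<int>)"
proof -
  have "tube_fn w i c x = 0 \<longleftrightarrow> (\<forall>b. cos (2 * pi * transverse w i (x - c) $ b) = 1)"
    unfolding tube_fn_def by (subst sum_nonneg_eq_0_iff) auto
  also have "\<dots> \<longleftrightarrow> (\<forall>b. transverse w i (x - c) $ b \<in> \<int>)"
    by (auto simp: cos_one_2pi_int Ints_def mult.commute)
  finally show ?thesis .
qed

text \<open>The cosine depends only on the distance \<open>y\<close> of \<open>x\<close> to the
  nearest integer. On \<open>0 \<le> y \<le> 1 / 2\<close> it decreases and vanishes at
  \<open>1 / 4\<close>.\<close>

lemma round_near_if_cos_pos:
  assumes "0 < cos (2 * pi * x)"
  shows "\<bar>x - of_int (round x)\<bar> < 1 / 4"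
proof (rule ccontr)
  define y where "y = \<bar>x - of_int (round x)\<bar>"
  assume "\<not> ?thesis"
  then have y: "1 / 4 \<le> y" "y \<le> 1 / 2"
    using of_int_round_abs_le[of x] by (auto simp: y_def abs_minus_commute)
  have "cos (2 * pi * x) = cos (2 * pi * (x - of_int (round x)))"
    using cos_add_2pi_Ints[of "- of_int (round x)" x] by simp
  also have "\<dots> = cos (2 * pi * y)"
    by (simp add: y_def abs_if right_diff_distrib) (metis cos_minus minus_diff_eq)
  also have "\<dots> \<le> cos (pi / 2)"
    using y by (intro cos_monotone_0_pi_le) auto
  finally show False using assms by simp
qed

text \<open>The integers \<open>m\<close> select one line of the zero set of \<open>tube_fn w i c\<close>.\<close>

definition tube :: "real \<Rightarrow> real ^ 'n \<Rightarrow> 'n \<Rightarrow> real ^ 'n \<Rightarrow> ('n \<Rightarrow> int) \<Rightarrow> (real ^ 'n) set" where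
  "tube \<eta> w i c m = {y. tube_fn w i c y < \<eta> \<and> (\<forall>b. \<bar>transverse w i (y - c) $ b - m b\<bar> < 1 / 4)}"

lemma open_tube: "open (tube \<eta> w i c m)"
proof -
  have 1: "continuous_on UNIV (\<lambda>y. transverse w i (y - c) $ b)" for b
    unfolding transverse_def by (auto intro!: continuous_intros)
  have "tube \<eta> w i c m = {y. tube_fn w i c y < \<eta>} \<inter>
      (\<Inter>b\<in>UNIV. {y. \<bar>transverse w i (y - c) $ b - m b\<bar> < 1 / 4})"
    by (auto simp: tube_def)
  also have "open \<dots>"
    by (intro open_Int open_INT open_Collect_less smooth_continuous[OF smooth_tube_fn] ballI
        continuous_intros 1) auto
  finally show ?thesis .
qed

text \<open>Since \<open>\<eta> \<le> 1\<close>, every summand \<open>1 - cos\<close> is below 1.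
  All the cosines are therefore positive, and rounding the transverse coordinates finds the
  tube.\<close>

lemma in_some_tube:
  assumes "\<eta> \<le> 1" "tube_fn w i c y < \<eta>"
  obtains m where "y \<in> tube \<eta> w i c m"
proof
  have "0 < cos (2 * pi * transverse w i (y - c) $ b)" for b
    using tube_fn_term_le[of w i y c b] assms by linarith
  then show "y \<in> tube \<eta> w i c (\<lambda>b. round (transverse w i (y - c) $ b))"
    using assms(2) round_near_if_cos_pos by (auto simp: tube_def)
qed

text \<open>Distinct integers differ by at least 1, and the windows around them have radius
  \<open>1 / 4\<close>; this leaves a gap of \<open>1 / 2\<close> in some transverse
  coordinate.\<close>

lemma tubes_separated_same_direction:
  assumes "y \<in> tube \<eta> w i c m" "y' \<in> tube \<eta> w i c m'" "m \<noteq> m'"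
  shows "1 / 2 \<le> 2 * norm w * norm (y - y')"
proof -
  obtain b where b: "m b \<noteq> m' b" using assms(3) by blast
  then have "1 \<le> \<bar>real_of_int (m b) - real_of_int (m' b)\<bar>"
    by linarith
  moreover have "\<bar>transverse w i (y - c) $ b - m b\<bar> < 1 / 4" "\<bar>transverse w i (y' - c) $ b - m' b\<bar> < 1 / 4"
    using assms(1,2) by (auto simp: tube_def)
  ultimately have "1 / 2 \<le> \<bar>transverse w i (y - y') $ b\<bar>"
    unfolding transverse_linear vector_minus_component by arith
  also have "\<dots> \<le> 2 * norm w * norm (y - y')" by (rule transverse_bound)
  finally show ?thesis .
qed

text \<open>
  On each tube this is the affine function of \<open>p\<close> evaluated at the orthogonal projection to the
  core line, so that its gradient is the component of \<open>p\<close> along the tube.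
\<close>

definition core_value :: "real ^ 'n \<Rightarrow> real ^ 'n \<Rightarrow> 'n \<Rightarrow> real ^ 'n \<Rightarrow> ('n \<Rightarrow> int) \<Rightarrow> real ^ 'n \<Rightarrow> real" where
  "core_value p w i c m y =
     (let l = c + (1 / w $ i) *\<^sub>R (\<chi> b. of_int (m b)) in
      p \<bullet> l + ((y - l) \<bullet> w) * (p \<bullet> w) / (w \<bullet> w))"

lemma core_value_diff:
  "\<bar>core_value p w i c m y - core_value p w i c m y'\<bar> \<le> \<bar>p \<bullet> w\<bar> / norm w * norm (y - y')"
proof (cases "w = 0")
  case False
  have "core_value p w i c m y - core_value p w i c m y' = ((y - y') \<bullet> w) * (p \<bullet> w) / (w \<bullet> w)"
    by (simp add: core_value_def Let_def inner_diff_left algebra_simps diff_divide_distrib)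
  also have "\<bar>\<dots>\<bar> = \<bar>(y - y') \<bullet> w\<bar> * \<bar>p \<bullet> w\<bar> / (norm w)\<^sup>2"
    by (simp add: abs_mult dot_square_norm)
  also have "\<dots> \<le> (norm (y - y') * norm w) * \<bar>p \<bullet> w\<bar> / (norm w)\<^sup>2"
    by (intro divide_right_mono mult_right_mono Cauchy_Schwarz_ineq2) auto
  also have "\<dots> = \<bar>p \<bullet> w\<bar> / norm w * norm (y - y')"
    using False by (simp add: power2_eq_square)
  finally show ?thesis .
qed (simp add: core_value_def)

text \<open>By \<open>transverse_decomposition\<close>, \<open>y - l\<close> is a multiple of
  \<open>w\<close> plus a remainder \<open>r\<close>. Along \<open>w\<close> the core value agrees
  with \<open>p\<close>, so only \<open>r\<close> contributes, and its coordinates are at most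
  \<open>1 / 4\<close> because a nonzero integer \<open>w $ i\<close> has modulus at least
  1.\<close>

lemma core_value_near:
  fixes w :: "real ^ 'n"
  assumes y: "y \<in> tube \<eta> w i c m" and w: "integer_vector w" "w $ i \<noteq> 0"
  shows "\<bar>core_value p w i c m y - p \<bullet> y\<bar> \<le> real CARD('n) * norm p"
proof -
  define l where "l = c + (1 / w $ i) *\<^sub>R (\<chi> b. of_int (m b))"
  define r where "r = (1 / w $ i) *\<^sub>R (transverse w i (y - c) - (\<chi> b. of_int (m b)))"
  define \<tau> where "\<tau> = (y - c) $ i / w $ i"
  have yl: "y - l = \<tau> *\<^sub>R w + r"
    using transverse_decomposition[of w i "y - c"] w(2)
    by (simp add: l_def r_def \<tau>_def algebra_simps)
  have wi: "1 \<le> \<bar>w $ i\<bar>"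
    using w by (auto simp: integer_vector_def intro!: Ints_nonzero_abs_ge1)
  have "norm r \<le> (\<Sum>b\<in>UNIV. \<bar>r $ b\<bar>)" by (rule norm_le_l1_cart)
  also have "\<dots> \<le> (\<Sum>b\<in>(UNIV :: 'n set). 1 / 4)"
  proof (rule sum_mono)
    fix b
    have "\<bar>r $ b\<bar> = \<bar>transverse w i (y - c) $ b - m b\<bar> / \<bar>w $ i\<bar>"
      by (simp add: r_def abs_mult)
    also have "\<dots> \<le> (1 / 4) / 1"
      using y wi by (intro frac_le) (auto simp: tube_def less_imp_le)
    finally show "\<bar>r $ b\<bar> \<le> 1 / 4" by simp
  qed
  finally have r: "norm r \<le> real CARD('n) / 4" by simp
  have "w \<noteq> 0" using w(2) by auto
  then have "core_value p w i c m y - p \<bullet> y = (r \<bullet> w) * (p \<bullet> w) / (w \<bullet> w) - p \<bullet> r"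
    using yl by (simp add: core_value_def Let_def flip: l_def)
      (simp add: inner_add_left inner_add_right algebra_simps add_divide_distrib eq_diff_eq)
  also have "\<bar>\<dots>\<bar> \<le> \<bar>(r \<bullet> w) * (p \<bullet> w) / (w \<bullet> w)\<bar> + \<bar>p \<bullet> r\<bar>" by (rule abs_triangle_ineq4)
  also have "\<bar>(r \<bullet> w) * (p \<bullet> w) / (w \<bullet> w)\<bar> = \<bar>r \<bullet> w\<bar> * \<bar>p \<bullet> w\<bar> / (norm w)\<^sup>2"
    by (simp add: abs_mult dot_square_norm)
  also have "\<dots> \<le> (norm r * norm w) * (norm p * norm w) / (norm w)\<^sup>2"
    by (intro divide_right_mono mult_mono Cauchy_Schwarz_ineq2) auto
  also have "\<dots> = norm p * norm r" using \<open>w \<noteq> 0\<close> by (simp add: power2_eq_square)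
  also have "\<bar>p \<bullet> r\<bar> \<le> norm p * norm r" by (rule Cauchy_Schwarz_ineq2)
  also have "norm p * norm r + norm p * norm r \<le> norm p * (real CARD('n) / 4) + norm p * (real CARD('n) / 4)"
    using r by (intro add_mono mult_left_mono) auto
  also have "\<dots> \<le> real CARD('n) * norm p" by simp
  finally show ?thesis by simp
qed

text \<open>Compactness of the torus: subtracting integer parts moves every point into the unit
  cube.\<close>

lemma torus_periodic_lower_bound:
  fixes f :: "real ^ 'n \<Rightarrow> real"
  assumes "torus_periodic f" "continuous_on UNIV f" "\<And>x. 0 < f x"
  obtains e where "e > 0" "\<And>x. e \<le> f x"
proof -
  let ?Q = "cbox 0 (1 :: real ^ 'n)"
  have "continuous_on ?Q f" using assms(2) continuous_on_subset by blast
  moreover have "0 \<in> ?Q" by (simp add: mem_box_cart)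
  ultimately obtain z where z: "\<And>x. x \<in> ?Q \<Longrightarrow> f z \<le> f x"
    using continuous_attains_inf[of ?Q f] by (metis compact_cbox empty_iff)
  have "f z \<le> f x" for x
  proof -
    define k :: "real ^ 'n" where "k = (\<chi> b. - of_int \<lfloor>x $ b\<rfloor>)"
    have "integer_vector k" by (simp add: integer_vector_def k_def)
    then have "f (x + k) = f x" using assms(1) by (simp add: torus_periodic_def)
    moreover have "0 \<le> x $ b + - of_int \<lfloor>x $ b\<rfloor> \<and> x $ b + - of_int \<lfloor>x $ b\<rfloor> \<le> 1" for b
      by linarith
    then have "x + k \<in> ?Q" by (simp add: mem_box_cart k_def)
    ultimately show ?thesis using z by metis
  qed
  then show ?thesis using that assms(3) by blast
qed

section \<open>Disjoint tubes and potentials\<close>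

text \<open>
  Two closed geodesics in directions \<open>v\<close> and \<open>w\<close> can only meet if their base points differ by an
  element of this set, a countable union of planes.
\<close>

definition rational_offsets :: "real ^ 'n \<Rightarrow> real ^ 'n \<Rightarrow> (real ^ 'n) set" where
  "rational_offsets v w = {\<alpha> *\<^sub>R v + \<beta> *\<^sub>R w + \<rho> | \<alpha> \<beta> \<rho>. \<forall>b. \<rho> $ b \<in> \<rat>}"

lemma rational_offsetsI:
  "x = \<alpha> *\<^sub>R v + \<beta> *\<^sub>R w + \<rho> \<Longrightarrow> \<forall>b. \<rho> $ b \<in> \<rat> \<Longrightarrow> x \<in> rational_offsets v w"
  unfolding rational_offsets_def by blast

text \<open>A span of two vectors is a null set in dimension at least 3, and so is the union of its
  countably many rational translates. This is what makes room for disjoint geodesics.\<close>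

lemma negligible_rational_offsets:
  fixes v w :: "real ^ 'n"
  assumes "CARD('n) \<ge> 3"
  shows "negligible (rational_offsets v w)"
proof -
  define R where "R = {\<rho> :: real ^ 'n. \<forall>b. \<rho> $ b \<in> \<rat>}"
  have "R \<subseteq> range (\<lambda>z :: rat ^ 'n. \<chi> b. of_rat (z $ b))"
  proof
    fix \<rho> assume "\<rho> \<in> R"
    then have "\<forall>b. \<exists>z. \<rho> $ b = of_rat z" by (auto simp: R_def Rats_def)
    then obtain z where "\<And>b. \<rho> $ b = of_rat (z b)" by metis
    then have "\<rho> = (\<chi> b. of_rat ((\<chi> b. z b) $ b))" by (simp add: vec_eq_iff)
    then show "\<rho> \<in> range (\<lambda>z :: rat ^ 'n. \<chi> b. of_rat (z $ b))" by blast
  qed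
  then have R: "countable R" by (rule countable_subset) simp
  have "dim (span {v, w}) \<le> card {v, w}" by (simp add: dim_le_card')
  also have "\<dots> \<le> 2" by (simp add: card_insert_if)
  finally have "negligible (span {v, w})"
    using assms by (intro negligible_lowdim) simp
  then have "negligible (\<Union>\<rho>\<in>R. (+) \<rho> ` span {v, w})"
    using R by (intro negligible_countable_Union) (auto intro: negligible_translation)
  moreover have "rational_offsets v w \<subseteq> (\<Union>\<rho>\<in>R. (+) \<rho> ` span {v, w})"
  proof
    fix x assume "x \<in> rational_offsets v w"
    then obtain \<alpha> \<beta> \<rho> where x: "x = \<alpha> *\<^sub>R v + \<beta> *\<^sub>R w + \<rho>" and \<rho>: "\<rho> \<in> R"
      by (auto simp: rational_offsets_def R_def)
    have "\<alpha> *\<^sub>R v + \<beta> *\<^sub>R w \<in> span {v, w}"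
      by (intro span_add span_scale span_base) auto
    then have "x \<in> (+) \<rho> ` span {v, w}"
      unfolding x by (rule image_eqI[rotated]) simp
    then show "x \<in> (\<Union>\<rho>\<in>R. (+) \<rho> ` span {v, w})" using \<rho> by blast
  qed
  ultimately show ?thesis by (rule negligible_subset)
qed

text \<open>The points are chosen one after another; each has to avoid finitely many translated null
  sets. The negated conjunction is symmetric in the pair, so keeping \<open>x - c q\<close> out of
  \<open>B v q\<close> settles both orders.\<close>

lemma points_avoiding_negligible_offsets:
  fixes B :: "'i \<Rightarrow> 'i \<Rightarrow> (real ^ 'n) set"
  assumes "finite V" and "\<And>q q'. negligible (B q q')"
  shows "\<exists>c. \<forall>q\<in>V. \<forall>q'\<in>V. q \<noteq> q' \<longrightarrow> \<not> (c q - c q' \<in> B q q' \<and> c q' - c q \<in> B q' q)"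
  using assms(1)
proof induction
  case (insert v V)
  then obtain c where c: "\<forall>q\<in>V. \<forall>q'\<in>V. q \<noteq> q' \<longrightarrow> \<not> (c q - c q' \<in> B q q' \<and> c q' - c q \<in> B q' q)"
    by blast
  have "negligible (\<Union>q\<in>V. (+) (c q) ` B v q)"
    using insert.hyps(1) assms(2) by (intro negligible_Union) (auto intro: negligible_translation)
  then have "(\<Union>q\<in>V. (+) (c q) ` B v q) \<noteq> UNIV"
    using non_negligible_UNIV by metis
  then obtain x where x: "x \<notin> (\<Union>q\<in>V. (+) (c q) ` B v q)" by blast
  have "x - c q \<notin> B v q" if "q \<in> V" for q
  proof
    assume "x - c q \<in> B v q"
    then have "x \<in> (+) (c q) ` B v q" by (intro image_eqI[of _ _ "x - c q"]) auto
    then show False using x that by blast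
  qed
  then have "\<forall>q\<in>insert v V. \<forall>q'\<in>insert v V. q \<noteq> q' \<longrightarrow>
      \<not> ((c(v := x)) q - (c(v := x)) q' \<in> B q q' \<and> (c(v := x)) q' - (c(v := x)) q \<in> B q' q)"
    using c insert.hyps(2) by auto
  then show ?case by blast
qed simp

text \<open>At a zero the transverse coordinates are integers, and dividing by the integer
  \<open>w $ i\<close> leaves rationals.\<close>

lemma tube_fn_zero_offset:
  assumes "tube_fn w i c x = 0" "integer_vector w" "w $ i \<noteq> 0"
  obtains \<alpha> \<rho> where "x - c = \<alpha> *\<^sub>R w + \<rho>" "\<And>b. \<rho> $ b \<in> \<rat>"
proof
  show "x - c = ((x - c) $ i / w $ i) *\<^sub>R w + (1 / w $ i) *\<^sub>R transverse w i (x - c)"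
    by (rule transverse_decomposition[OF assms(3)])
  show "((1 / w $ i) *\<^sub>R transverse w i (x - c)) $ b \<in> \<rat>" for b
    using assms tube_fn_eq_0_iff[of w i c x] Ints_subset_Rats
    by (auto simp: integer_vector_def intro!: Rats_divide)
qed

text \<open>A common zero of two tube functions would make the difference of the base points a
  rational offset. Without common zeros the sum is positive, hence bounded below on the torus. The
  factor 4 leaves a margin: where one function is below \<open>\<eta>\<close>, the others exceed
  \<open>3 * \<eta>\<close>.\<close>

lemma exists_disjoint_tubes:
  fixes V :: "(real ^ 'n) set" and w :: "real ^ 'n \<Rightarrow> real ^ 'n"
  assumes card: "CARD('n) \<ge> 3" and V: "finite V"
    and w: "\<And>q. q \<in> V \<Longrightarrow> integer_vector (w q) \<and> w q $ i q \<noteq> 0"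
  obtains c \<eta> where "0 < \<eta>" "\<eta> \<le> 1"
    "\<And>q q' x. q \<in> V \<Longrightarrow> q' \<in> V \<Longrightarrow> q \<noteq> q' \<Longrightarrow>
       4 * \<eta> \<le> tube_fn (w q) (i q) (c q) x + tube_fn (w q') (i q') (c q') x"
proof -
  obtain c where c: "\<And>q q'. q \<in> V \<Longrightarrow> q' \<in> V \<Longrightarrow> q \<noteq> q' \<Longrightarrow>
      \<not> (c q - c q' \<in> rational_offsets (w q) (w q') \<and> c q' - c q \<in> rational_offsets (w q') (w q))"
    using points_avoiding_negligible_offsets[OF V, of "\<lambda>q q'. rational_offsets (w q) (w q')",
        OF negligible_rational_offsets[OF card]] by blast
  define F where "F q = tube_fn (w q) (i q) (c q)" for q
  have ex: "\<exists>e>0. \<forall>x. e \<le> F q x + F q' x" if q: "q \<in> V" "q' \<in> V" "q \<noteq> q'" for q q'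
  proof -
    have pos: "0 < F q x + F q' x" for x
    proof (rule ccontr)
      assume "\<not> 0 < F q x + F q' x"
      then have 0: "tube_fn (w q) (i q) (c q) x = 0" "tube_fn (w q') (i q') (c q') x = 0"
        using tube_fn_nonneg[of "w q" "i q" "c q" x] tube_fn_nonneg[of "w q'" "i q'" "c q'" x]
        unfolding F_def by linarith+
      have w1: "integer_vector (w q)" "w q $ i q \<noteq> 0" and w2: "integer_vector (w q')" "w q' $ i q' \<noteq> 0"
        using w q by auto
      obtain \<alpha> \<rho> where 1: "x - c q = \<alpha> *\<^sub>R w q + \<rho>" "\<And>b. \<rho> $ b \<in> \<rat>"
        using tube_fn_zero_offset[OF 0(1) w1] by blast
      obtain \<beta> \<sigma> where 2: "x - c q' = \<beta> *\<^sub>R w q' + \<sigma>" "\<And>b. \<sigma> $ b \<in> \<rat>"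
        using tube_fn_zero_offset[OF 0(2) w2] by blast
      have "c q - c q' = (- \<alpha>) *\<^sub>R w q + \<beta> *\<^sub>R w q' + (\<sigma> - \<rho>)"
        using 1(1) 2(1) by (simp add: algebra_simps)
      then have "c q - c q' \<in> rational_offsets (w q) (w q')"
        by (rule rational_offsetsI) (use 1(2) 2(2) in simp)
      moreover have "c q' - c q = (- \<beta>) *\<^sub>R w q' + \<alpha> *\<^sub>R w q + (\<rho> - \<sigma>)"
        using 1(1) 2(1) by (simp add: algebra_simps)
      then have "c q' - c q \<in> rational_offsets (w q') (w q)"
        by (rule rational_offsetsI) (use 1(2) 2(2) in simp)
      ultimately show False using c[OF q] by blast
    qed
    have "torus_periodic (F q)" "torus_periodic (F q')"
      using w q by (simp_all add: F_def tube_fn_periodic)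
    then have per: "torus_periodic (\<lambda>x. F q x + F q' x)"
      by (simp add: torus_periodic_def)
    have cont: "continuous_on UNIV (\<lambda>x. F q x + F q' x)"
      unfolding F_def by (intro continuous_on_add smooth_continuous smooth_tube_fn)
    obtain e where "e > 0" "\<And>x. e \<le> F q x + F q' x"
      by (rule torus_periodic_lower_bound[OF per cont pos]) (rule that)
    then show ?thesis by blast
  qed
  have "\<exists>e>0. \<forall>q\<in>V. \<forall>q'\<in>V. q \<noteq> q' \<longrightarrow> (\<forall>x. e \<le> F q x + F q' x)"
  proof -
    define e where "e q q' = (SOME e. e > 0 \<and> (\<forall>x. e \<le> F q x + F q' x))" for q q'
    have e': "e q q' > 0 \<and> (\<forall>x. e q q' \<le> F q x + F q' x)" if "q \<in> V" "q' \<in> V" "q \<noteq> q'" for q q'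
      unfolding e_def using ex[OF that] by (rule someI_ex)
    have e: "e q q' > 0" "e q q' \<le> F q x + F q' x" if "q \<in> V" "q' \<in> V" "q \<noteq> q'" for q q' x
      using e'[OF that] by simp_all
    \<comment> \<open>The element 1 keeps the set nonempty when \<open>V\<close> has no two distinct
      elements.\<close>
    define S where "S = insert 1 ((\<lambda>(q, q'). e q q') ` {(q, q') \<in> V \<times> V. q \<noteq> q'})"
    have "finite {(q, q') \<in> V \<times> V. q \<noteq> q'}"
      by (rule finite_subset[of _ "V \<times> V"]) (use V in auto)
    then have "finite S" by (simp add: S_def)
    moreover have "S \<noteq> {}" by (simp add: S_def)
    moreover have "0 < x" if "x \<in> S" for x
      using that e(1) by (auto simp: S_def)
    ultimately have "0 < Min S" by (simp add: Min_gr_iff)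
    moreover have "Min S \<le> F q x + F q' x" if "q \<in> V" "q' \<in> V" "q \<noteq> q'" for q q' x
    proof -
      have "Min S \<le> e q q'" using \<open>finite S\<close> that by (intro Min_le) (auto simp: S_def)
      also have "\<dots> \<le> F q x + F q' x" by (rule e(2)[OF that])
      finally show ?thesis .
    qed
    ultimately show ?thesis
      by (intro exI[of _ "Min S"] conjI ballI impI allI)
  qed
  then obtain e where e0: "e > 0" and e1: "\<forall>q\<in>V. \<forall>q'\<in>V. q \<noteq> q' \<longrightarrow> (\<forall>x. e \<le> F q x + F q' x)"
    by (elim exE conjE)
  have e: "e > 0" "\<And>q q' x. q \<in> V \<Longrightarrow> q' \<in> V \<Longrightarrow> q \<noteq> q' \<Longrightarrow> e \<le> F q x + F q' x"
    using e0 e1 by simp_all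
  show ?thesis
  proof
    show "0 < min 1 (e / 4)" "min 1 (e / 4) \<le> 1" using e(1) by auto
    show "4 * min 1 (e / 4) \<le> tube_fn (w q) (i q) (c q) x + tube_fn (w q') (i q') (c q') x"
      if "q \<in> V" "q' \<in> V" "q \<noteq> q'" for q q' x
      using e(2)[OF that, of x] unfolding F_def by linarith
  qed
qed

lemma integer_vector_near:
  fixes x :: "real ^ 'n"
  obtains z where "integer_vector z" "norm (x - z) \<le> real CARD('n)"
proof
  let ?z = "\<chi> b. of_int \<lfloor>x $ b\<rfloor> :: real ^ 'n"
  show "integer_vector ?z" by (simp add: integer_vector_def)
  have "norm (x - ?z) \<le> (\<Sum>b\<in>UNIV. \<bar>(x - ?z) $ b\<bar>)" by (rule norm_le_l1_cart)
  also have "\<dots> \<le> (\<Sum>b\<in>(UNIV :: 'n set). 1)"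
    by (intro sum_mono) (simp, linarith)
  finally show "norm (x - ?z) \<le> real CARD('n)" by simp
qed

text \<open>The core values on the union of all tubes are extended to a Lipschitz function.
  Different tubes have distance at least \<open>r\<close>, and core values differ from
  \<open>p\<close> by a bounded multiple of \<open>norm p\<close>, so passing between tubes has
  slope at most \<open>K * norm p\<close>. It matters that \<open>K\<close> and \<open>C\<close> are
  independent of \<open>p\<close>: the speed off the tubes is chosen from \<open>K\<close> before
  \<open>p\<close> is given.\<close>

lemma tube_potential:
  fixes V :: "(real ^ 'n) set" and w c :: "real ^ 'n \<Rightarrow> real ^ 'n" and i :: "real ^ 'n \<Rightarrow> 'n"
  defines "F \<equiv> \<lambda>q. tube_fn (w q) (i q) (c q)"
  assumes V: "finite V" "V \<noteq> {}" and \<eta>: "0 < \<eta>" "\<eta> \<le> 1"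
    and w: "\<And>q. q \<in> V \<Longrightarrow> integer_vector (w q) \<and> w q $ i q \<noteq> 0"
    and disj: "\<And>q q' x. q \<in> V \<Longrightarrow> q' \<in> V \<Longrightarrow> q \<noteq> q' \<Longrightarrow> 4 * \<eta> \<le> F q x + F q' x"
  obtains K C where "K \<ge> 1" "C \<ge> 0" "\<And>p. \<exists>u.
      (\<forall>x y. \<bar>u x - u y\<bar> \<le> K * norm p * dist x y) \<and>
      (\<forall>x. \<bar>u x - p \<bullet> x\<bar> \<le> C * norm p) \<and>
      (\<forall>q\<in>V. \<forall>x. F q x < \<eta> \<longrightarrow>
         (\<forall>\<^sub>F y in nhds x. \<bar>u y - u x\<bar> \<le> \<bar>p \<bullet> w q\<bar> / norm (w q) * norm (y - x)))"
proof -
  let ?n = "real CARD('n)"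
  define T where "T = (\<lambda>(q, m). tube \<eta> (w q) (i q) (c q) m)"
  define W where "W = 1 + (\<Sum>q\<in>V. norm (w q))"
  have W: "1 \<le> W" by (simp add: W_def sum_nonneg)
  have wW: "norm (w q) \<le> W" if "q \<in> V" for q
    using member_le_sum[OF that, of "\<lambda>q. norm (w q)"] V(1) by (simp add: W_def)
  \<comment> \<open>The first term separates parallel tubes of one vertex, the second tubes of
    different vertices.\<close>
  define r where "r = min (1 / (4 * W)) (\<eta> / (?n * (4 * pi * W)))"
  have r: "0 < r" using W \<eta> by (simp add: r_def)
  have sep: "r \<le> dist y y'" if j: "y \<in> T (q, m)" "y' \<in> T (q', m')" "q \<in> V" "q' \<in> V" "(q, m) \<noteq> (q', m')"
    for y y' q q' m m'
  proof (cases "q = q'")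
    case True
    then have "1 / 2 \<le> 2 * norm (w q) * norm (y - y')"
      using j by (intro tubes_separated_same_direction) (auto simp: T_def)
    also have "\<dots> \<le> 2 * W * norm (y - y')"
      using wW[OF j(3)] by (intro mult_right_mono mult_left_mono) auto
    finally have "1 / (4 * W) \<le> norm (y - y')" using W by (simp add: field_simps)
    then show ?thesis by (simp add: r_def dist_norm min_le_iff_disj)
  next
    case False
    have "F q y < \<eta>" "F q' y' < \<eta>" using j by (auto simp: T_def tube_def F_def)
    then have "\<eta> \<le> \<bar>F q' y - F q' y'\<bar>"
      using disj[OF j(3,4) False, of y] \<eta>(1) by linarith
    also have "\<dots> \<le> ?n * (4 * pi * norm (w q')) * norm (y - y')"
      unfolding F_def by (rule tube_fn_lipschitz)
    also have "\<dots> \<le> ?n * (4 * pi * W) * norm (y - y')"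
      using wW[OF j(4)] by (intro mult_right_mono mult_left_mono) auto
    finally have "\<eta> / (?n * (4 * pi * W)) \<le> norm (y - y')"
      using W by (simp add: pos_divide_le_eq mult.commute)
    then show ?thesis by (simp add: r_def dist_norm min_le_iff_disj)
  qed
  define K where "K = 1 + 2 * ?n / r"
  have K: "K \<ge> 1" using r by (simp add: K_def)
  \<comment> \<open>Going from \<open>x\<close> to a tube point within distance \<open>n\<close>
    changes \<open>u\<close> by at most \<open>K * n * norm p\<close> and the linear function by
    \<open>n * norm p\<close>; the core value there contributes another
    \<open>n * norm p\<close>.\<close>
  define C where "C = K * ?n + 2 * ?n"
  have "\<exists>u. (\<forall>x y. \<bar>u x - u y\<bar> \<le> K * norm p * dist x y) \<and>
      (\<forall>x. \<bar>u x - p \<bullet> x\<bar> \<le> C * norm p) \<and>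
      (\<forall>q\<in>V. \<forall>x. F q x < \<eta> \<longrightarrow>
         (\<forall>\<^sub>F y in nhds x. \<bar>u y - u x\<bar> \<le> \<bar>p \<bullet> w q\<bar> / norm (w q) * norm (y - x)))" for p
  proof -
    define g where "g = (\<lambda>(q, m). core_value p (w q) (i q) (c q) m)"
    define TT where "TT = (\<Union>j\<in>V \<times> UNIV. T j)"
    \<comment> \<open>The choice is unambiguous: by \<open>sep\<close> with equal points, no point
      lies in two tubes.\<close>
    define G where "G y = g (SOME j. j \<in> V \<times> UNIV \<and> y \<in> T j) y" for y
    have gT: "\<bar>g j y - p \<bullet> y\<bar> \<le> ?n * norm p" if "j \<in> V \<times> UNIV" "y \<in> T j" for j y
      using that w by (auto simp: g_def T_def intro!: core_value_near)
    have gl: "\<bar>g (q, m) y - g (q, m) y'\<bar> \<le> \<bar>p \<bullet> w q\<bar> / norm (w q) * dist y y'" for q m y y'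
      using core_value_diff[of p "w q" "i q" "c q" m y y'] by (simp add: g_def dist_norm)
    have slope: "\<bar>p \<bullet> w q\<bar> / norm (w q) \<le> norm p" for q
      using Cauchy_Schwarz_ineq2[of p "w q"] by (cases "w q = 0") (simp_all add: pos_divide_le_eq)
    have G: "G y = g j y" if j: "j \<in> V \<times> UNIV" "y \<in> T j" for j y
    proof -
      let ?j = "SOME j. j \<in> V \<times> UNIV \<and> y \<in> T j"
      have s: "?j \<in> V \<times> UNIV \<and> y \<in> T ?j"
        by (rule someI[of "\<lambda>j. j \<in> V \<times> UNIV \<and> y \<in> T j" j]) (use j in simp)
      have "?j = j"
      proof (rule ccontr)
        assume "?j \<noteq> j"
        then have "r \<le> dist y y"
          using sep[of y "fst ?j" "snd ?j" y "fst j" "snd j"] s j by (auto simp: mem_Times_iff)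
        then show False using r by simp
      qed
      then show ?thesis by (simp add: G_def)
    qed
    have Glip: "G y - G y' \<le> K * norm p * dist y y'" if yy: "y \<in> TT" "y' \<in> TT" for y y'
    proof -
      obtain q m where j: "q \<in> V" "y \<in> T (q, m)" using yy(1) by (auto simp: TT_def)
      obtain q' m' where j': "q' \<in> V" "y' \<in> T (q', m')" using yy(2) by (auto simp: TT_def)
      have GG: "G y = g (q, m) y" "G y' = g (q', m') y'" using j j' by (simp_all add: G)
      show ?thesis
      proof (cases "(q, m) = (q', m')")
        case True
        then have "G y - G y' \<le> \<bar>p \<bullet> w q\<bar> / norm (w q) * dist y y'"
          using gl[of q m y y'] GG by simp
        also have "\<dots> \<le> 1 * norm p * dist y y'"
          using slope by (intro mult_right_mono) auto
        also have "\<dots> \<le> K * norm p * dist y y'"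
          using K by (intro mult_right_mono) auto
        finally show ?thesis .
      next
        case False
        have "G y - G y' \<le> p \<bullet> (y - y') + 2 * ?n * norm p"
          using gT[of "(q, m)" y] gT[of "(q', m')" y'] j j' GG by (simp add: inner_diff_right)
        also have "\<dots> \<le> norm p * dist y y' + 2 * ?n * norm p"
          using norm_cauchy_schwarz[of p "y - y'"] by (simp add: dist_norm)
        also have "2 * ?n * norm p = 2 * ?n / r * norm p * r" using r by simp
        also have "norm p * dist y y' + 2 * ?n / r * norm p * r
            \<le> norm p * dist y y' + 2 * ?n / r * norm p * dist y y'"
          using sep[OF j(2) j'(2) j(1) j'(1) False] r
          by (intro add_left_mono mult_left_mono) auto
        finally show ?thesis by (simp add: K_def algebra_simps)
      qed
    qed
    obtain q0 where q0: "q0 \<in> V" using V(2) by blast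
    \<comment> \<open>The integer translates of one base point lie on core lines and already come
      within distance \<open>n\<close> of every point.\<close>
    have near: "\<exists>y\<in>TT. dist x y \<le> ?n" for x
    proof -
      obtain z where z: "integer_vector z" "norm ((x - c q0) - z) \<le> ?n"
        by (rule integer_vector_near)
      have "F q0 (c q0 + z) = F q0 (c q0)"
        using tube_fn_periodic[of "w q0" "i q0" "c q0"] w[OF q0] z(1) by (simp add: F_def torus_periodic_def)
      then have "tube_fn (w q0) (i q0) (c q0) (c q0 + z) < \<eta>"
        using \<eta>(1) by (simp add: F_def tube_fn_base)
      then obtain m where "c q0 + z \<in> tube \<eta> (w q0) (i q0) (c q0) m"
        using in_some_tube[OF \<eta>(2)] by blast
      then have "c q0 + z \<in> TT" using q0 by (auto simp: TT_def T_def)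
      moreover have "dist x (c q0 + z) \<le> ?n" using z(2) by (simp add: dist_norm diff_diff_add)
      ultimately show ?thesis by blast
    qed
    have "TT \<noteq> {}" using near[of 0] by blast
    moreover have "0 \<le> K * norm p" using K by simp
    ultimately obtain u where u: "\<And>x. x \<in> TT \<Longrightarrow> u x = G x" "\<And>x y. \<bar>u x - u y\<bar> \<le> K * norm p * dist x y"
      using lipschitz_extension[of TT G "K * norm p", OF _ Glip] by blast
    have u3: "\<bar>u x - p \<bullet> x\<bar> \<le> C * norm p" for x
    proof -
      obtain y where y: "y \<in> TT" "dist x y \<le> ?n" using near by blast
      obtain j where j: "j \<in> V \<times> UNIV" "y \<in> T j" using y(1) by (auto simp: TT_def)
      have "K * norm p * dist x y \<le> K * norm p * ?n"
        using y(2) K by (intro mult_left_mono) auto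
      then have "\<bar>u x - u y\<bar> \<le> K * norm p * ?n"
        using u(2)[of x y] by linarith
      moreover have "\<bar>u y - p \<bullet> y\<bar> \<le> ?n * norm p"
        using gT[OF j] G[OF j] u(1)[OF y(1)] by simp
      moreover have "\<bar>p \<bullet> y - p \<bullet> x\<bar> \<le> norm p * ?n"
        using Cauchy_Schwarz_ineq2[of p "x - y"] mult_left_mono[OF y(2), of "norm p"]
        by (simp add: inner_diff_right dist_norm abs_minus_commute)
      ultimately show ?thesis by (simp add: C_def algebra_simps)
    qed
    \<comment> \<open>Tubes are open, so near \<open>x\<close> the function \<open>u\<close> is the
      core value of a single tube.\<close>
    have u4: "\<forall>\<^sub>F y in nhds x. \<bar>u y - u x\<bar> \<le> \<bar>p \<bullet> w q\<bar> / norm (w q) * norm (y - x)"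
      if q: "q \<in> V" "F q x < \<eta>" for q x
    proof -
      obtain m where "x \<in> tube \<eta> (w q) (i q) (c q) m"
        using in_some_tube[OF \<eta>(2) q(2)[unfolded F_def]] by blast
      then have m: "x \<in> T (q, m)" by (simp add: T_def)
      have "open (T (q, m))" by (simp add: T_def open_tube)
      then have "\<forall>\<^sub>F y in nhds x. y \<in> T (q, m)" using m by (rule eventually_nhds_in_open)
      then show ?thesis
      proof eventually_elim
        case (elim y)
        have "x \<in> TT" "y \<in> TT" using elim m q(1) by (auto simp: TT_def)
        then have "u y = g (q, m) y" "u x = g (q, m) x"
          using elim m q(1) by (simp_all add: u(1) G[of "(q, m)"])
        then show ?case using gl[of q m y x] by (simp add: dist_norm)
      qed
    qed
    show ?thesis
      by (intro exI[of _ u] conjI allI ballI impI u(2) u3 u4)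
  qed
  note ex = this
  have "C \<ge> 0" using K by (simp add: C_def)
  then show ?thesis by (rule that[OF K _ ex])
qed

section \<open>The limit shape\<close>

lemma hausdorff_dist_le:
  assumes "\<And>x. x \<in> A \<Longrightarrow> \<exists>y\<in>B. dist x y \<le> e" and "\<And>y. y \<in> B \<Longrightarrow> \<exists>x\<in>A. dist x y \<le> e"
  shows "hausdorff_dist A B \<le> ennreal e"
proof -
  have "(INF y\<in>B. ennreal (dist x y)) \<le> ennreal e" if x: "x \<in> A" for x
  proof -
    obtain y where y: "y \<in> B" "dist x y \<le> e" using assms(1)[OF x] by blast
    have "(INF y\<in>B. ennreal (dist x y)) \<le> ennreal (dist x y)" using y(1) by (rule INF_lower)
    also have "\<dots> \<le> ennreal e" using y(2) by (rule ennreal_leI)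
    finally show ?thesis .
  qed
  moreover have "(INF x\<in>A. ennreal (dist x y)) \<le> ennreal e" if y: "y \<in> B" for y
  proof -
    obtain x where x: "x \<in> A" "dist x y \<le> e" using assms(2)[OF y] by blast
    have "(INF x\<in>A. ennreal (dist x y)) \<le> ennreal (dist x y)" using x(1) by (rule INF_lower)
    also have "\<dots> \<le> ennreal e" using x(2) by (rule ennreal_leI)
    finally show ?thesis .
  qed
  ultimately show ?thesis unfolding hausdorff_dist_def by (intro max.boundedI SUP_least)
qed

text \<open>All errors, namely the extra time \<open>C\<close>, the lost time \<open>T\<close>, the
  displacement \<open>B\<close> and the starting point, are bounded in \<open>t\<close>. Rescaling
  by \<open>t\<close> makes them of order \<open>1 / t\<close>.\<close>

lemma has_limit_shapeI:
  fixes D :: "(real ^ 'n) set"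
  assumes D: "compact D" "convex D"
    and upper: "\<And>t x y. 0 < t \<Longrightarrow> y \<in> reachable_set a t x \<Longrightarrow> \<exists>z\<in>D. y = x + (t + C) *\<^sub>R z"
    and C: "0 \<le> C" and T: "0 \<le> T"
    and lower: "\<And>t x z. T \<le> t \<Longrightarrow> z \<in> D \<Longrightarrow>
        \<exists>y\<in>reachable_set a t x. norm (y - x - (t - T) *\<^sub>R z) \<le> B"
  shows "has_limit_shape a D"
  unfolding has_limit_shape_def
proof (intro conjI allI D)
  fix x :: "real ^ 'n"
  obtain M where M: "0 \<le> M" "\<And>z. z \<in> D \<Longrightarrow> norm z \<le> M"
    using compact_imp_bounded[OF D(1)] unfolding bounded_pos by (meson less_imp_le)
  \<comment> \<open>One constant that dominates the errors of both inclusions.\<close>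
  define Q where "Q = norm x + C * M + T * M + \<bar>B\<bar>"
  have bound: "hausdorff_dist ((\<lambda>y. y /\<^sub>R t) ` reachable_set a t x) D \<le> ennreal (Q / t)"
    if t: "max T 1 \<le> t" for t
  proof (rule hausdorff_dist_le)
    have t0: "0 < t" "T \<le> t" using t by auto
    fix y' assume "y' \<in> (\<lambda>y. y /\<^sub>R t) ` reachable_set a t x"
    then obtain y where y': "y' = y /\<^sub>R t" and y: "y \<in> reachable_set a t x" by blast
    obtain z where z: "z \<in> D" "y = x + (t + C) *\<^sub>R z" using upper[OF t0(1) y] by blast
    have "y' - z = (x + C *\<^sub>R z) /\<^sub>R t"
      using t0 by (simp add: y' z(2) algebra_simps)
    then have "dist y' z = norm (x + C *\<^sub>R z) / t"
      using t0 by (simp add: dist_norm divide_inverse mult.commute)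
    also have "norm (x + C *\<^sub>R z) \<le> norm x + C * M"
      using C M(2)[OF z(1)] by (intro norm_triangle_le add_left_mono) (simp add: mult_left_mono)
    also have "\<dots> \<le> Q" using T M(1) by (simp add: Q_def)
    finally show "\<exists>z\<in>D. dist y' z \<le> Q / t"
      using z(1) t0 by (auto simp: divide_right_mono)
  next
    have t0: "0 < t" "T \<le> t" using t by auto
    fix z assume z: "z \<in> D"
    obtain y where y: "y \<in> reachable_set a t x" "norm (y - x - (t - T) *\<^sub>R z) \<le> B"
      using lower[OF t0(2) z] by blast
    have "y /\<^sub>R t - z = ((y - x - (t - T) *\<^sub>R z) + (x - T *\<^sub>R z)) /\<^sub>R t"
      using t0 by (simp add: algebra_simps)
    then have "dist (y /\<^sub>R t) z = norm ((y - x - (t - T) *\<^sub>R z) + (x - T *\<^sub>R z)) / t"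
      using t0 by (simp only: dist_norm) (simp add: divide_inverse mult.commute)
    also have "norm ((y - x - (t - T) *\<^sub>R z) + (x - T *\<^sub>R z)) \<le> B + (norm x + norm (T *\<^sub>R z))"
      using y(2) by (intro norm_triangle_le add_mono norm_triangle_ineq4)
    also have "norm (T *\<^sub>R z) \<le> T * M"
      using T M(2)[OF z] by (simp add: mult_left_mono)
    also have "B + (norm x + T * M) \<le> Q"
      using mult_nonneg_nonneg[OF C M(1)] by (simp add: Q_def)
    finally have "dist (y /\<^sub>R t) z \<le> Q / t"
      using t0 by (simp add: divide_right_mono)
    then show "\<exists>y'\<in>(\<lambda>y. y /\<^sub>R t) ` reachable_set a t x. dist y' z \<le> Q / t"
      using y(1) by blast
  qed
  have "((\<lambda>t. Q / t) \<longlongrightarrow> 0) at_top"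
    by (rule tendsto_divide_0[OF tendsto_const filterlim_at_top_imp_at_infinity[OF filterlim_ident]])
  then have lim: "((\<lambda>t. ennreal (Q / t)) \<longlongrightarrow> 0) at_top"
    using tendsto_ennrealI[of "\<lambda>t. Q / t" 0 at_top] by simp
  have ev: "\<forall>\<^sub>F t in at_top. hausdorff_dist ((\<lambda>y. y /\<^sub>R t) ` reachable_set a t x) D \<le> ennreal (Q / t)"
    using eventually_ge_at_top[of "max T 1"] by eventually_elim (rule bound)
  show "((\<lambda>t. hausdorff_dist ((\<lambda>y. y /\<^sub>R t) ` reachable_set a t x) D) \<longlongrightarrow> 0) at_top"
    by (rule tendsto_sandwich[OF _ ev tendsto_const lim]) simp
qed

section \<open>Convex geometry of the target body\<close>

text \<open>A ball around \<open>x\<close> is carried to the origin by symmetry: \<open>y\<close> is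
  the midpoint of \<open>x + y\<close> and \<open>- (x - y)\<close>.\<close>

lemma symmetric_convex_contains_ball:
  fixes P :: "'a::real_normed_vector set"
  assumes "convex P" "centrally_symmetric P" "interior P \<noteq> {}"
  obtains \<rho> where "\<rho> > 0" "cball 0 \<rho> \<subseteq> P"
proof -
  obtain x e where e: "e > 0" "cball x e \<subseteq> P"
    using assms(3) by (auto simp: mem_interior_cball)
  have sym: "- z \<in> P" if "z \<in> P" for z
    using assms(2) that unfolding centrally_symmetric_def by blast
  have "cball 0 e \<subseteq> P"
  proof
    fix y assume "y \<in> cball (0 :: 'a) e"
    then have "x + y \<in> cball x e" "x - y \<in> cball x e" by (auto simp: dist_norm)
    then have "x + y \<in> P" "- (x - y) \<in> P" using e(2) sym by blast+
    then have "(1 / 2) *\<^sub>R (x + y) + (1 / 2) *\<^sub>R (- (x - y)) \<in> P"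
      using assms(1) by (intro convexD) auto
    moreover have "(1 / 2) *\<^sub>R (x + y) + (1 / 2) *\<^sub>R (- (x - y)) = y"
      by (simp add: algebra_simps flip: scaleR_add_left)
    ultimately show "y \<in> P" by simp
  qed
  then show ?thesis using that e(1) by blast
qed

text \<open>The bipolar theorem. A hyperplane separating \<open>z\<close> from \<open>P\<close> has
  a negative level \<open>b\<close>, since \<open>0 \<in> P\<close>; dividing by \<open>b\<close>
  reverses the inequalities and gives a polar vector that exceeds 1 at \<open>z\<close>.\<close>

lemma in_convex_if_polar_le:
  fixes P :: "'a::euclidean_space set"
  assumes P: "closed P" "convex P" "0 \<in> P"
    and le: "\<And>p. (\<And>x. x \<in> P \<Longrightarrow> p \<bullet> x \<le> 1) \<Longrightarrow> p \<bullet> z \<le> 1"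
  shows "z \<in> P"
proof (rule ccontr)
  assume "z \<notin> P"
  then obtain a b where ab: "a \<bullet> z < b" "\<And>x. x \<in> P \<Longrightarrow> b < a \<bullet> x"
    using separating_hyperplane_closed_point[OF P(2,1)] by blast
  have "b < 0" using ab(2)[OF P(3)] by simp
  then have "((1 / b) *\<^sub>R a) \<bullet> x \<le> 1" if "x \<in> P" for x
    using ab(2)[OF that] by (simp add: divide_le_eq)
  then have "((1 / b) *\<^sub>R a) \<bullet> z \<le> 1" by (rule le)
  then show False using ab(1) \<open>b < 0\<close> by (simp add: divide_le_eq)
qed

theorem theorem1p3:
  fixes P :: "(real ^ 'n) set"
  assumes "CARD('n) \<ge> 3"
    and "polytope P"
    and "centrally_symmetric P"
    and "has_rational_vertices P"
    and "interior P \<noteq> {}"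
  shows "\<exists>a :: real ^ 'n \<Rightarrow> real.
           smooth a \<and> torus_periodic a \<and> (\<forall>x. 0 < a x) \<and> \<not> a constant_on UNIV \<and>
           has_limit_shape a P"
proof -
  let ?n = "real CARD('n)"
  define V where "V = {q. q extreme_point_of P}"
  have P: "compact P" "convex P" "closed P"
    using assms(2) by (auto simp: polytope_imp_compact polytope_imp_convex compact_imp_closed)
  have hull: "P = convex hull V"
    unfolding V_def by (rule Krein_Milman_Minkowski[OF P(1,2)])
  have finV: "finite V"
    unfolding V_def by (rule finite_polyhedron_extreme_points[OF polytope_imp_polyhedron[OF assms(2)]])
  have "P \<noteq> {}" using assms(5) interior_subset by blast
  then have neV: "V \<noteq> {}" using hull by auto
  have VP: "V \<subseteq> P" using hull hull_subset by metis
  have sym: "- z \<in> P" if "z \<in> P" for z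
    using assms(3) that unfolding centrally_symmetric_def by blast
  obtain \<rho> where \<rho>: "\<rho> > 0" "cball 0 \<rho> \<subseteq> P"
    using symmetric_convex_contains_ball[OF P(2) assms(3,5)] .
  have "\<exists>s>0. integer_vector (s *\<^sub>R q)" and V0: "q \<noteq> 0" if "q \<in> V" for q
    using assms(4) that by (auto simp: has_rational_vertices_def rational_vector_def V_def)
  then obtain s where s: "\<And>q. q \<in> V \<Longrightarrow> s q > 0 \<and> integer_vector (s q *\<^sub>R q)" by metis
  define w where "w q = s q *\<^sub>R q" for q
  have "\<exists>i. w q $ i \<noteq> 0" if "q \<in> V" for q
    using s[OF that] V0[OF that] by (auto simp: w_def vec_eq_iff)
  then obtain i where i: "\<And>q. q \<in> V \<Longrightarrow> w q $ i q \<noteq> 0" by metis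
  have w: "integer_vector (w q) \<and> w q $ i q \<noteq> 0" if "q \<in> V" for q
    using s i that by (simp add: w_def)
  obtain c \<eta> where \<eta>: "0 < \<eta>" "\<eta> \<le> 1"
    and disj0: "\<And>q q' x. q \<in> V \<Longrightarrow> q' \<in> V \<Longrightarrow> q \<noteq> q' \<Longrightarrow>
       4 * \<eta> \<le> tube_fn (w q) (i q) (c q) x + tube_fn (w q') (i q') (c q') x"
    using exists_disjoint_tubes[OF assms(1) finV, of w i] w by metis
  define F where "F q = tube_fn (w q) (i q) (c q)" for q
  note disj = disj0[folded F_def]
  obtain K C where K: "K \<ge> 1" and C: "C \<ge> 0" and pot: "\<And>p. \<exists>u.
      (\<forall>x y. \<bar>u x - u y\<bar> \<le> K * norm p * dist x y) \<and>
      (\<forall>x. \<bar>u x - p \<bullet> x\<bar> \<le> C * norm p) \<and>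
      (\<forall>q\<in>V. \<forall>x. F q x < \<eta> \<longrightarrow>
         (\<forall>\<^sub>F y in nhds x. \<bar>u y - u x\<bar> \<le> \<bar>p \<bullet> w q\<bar> / norm (w q) * norm (y - x)))"
    unfolding F_def by (rule tube_potential[where \<eta> = \<eta> and V = V and w = w and i = i and c = c])
      (use finV neV \<eta> w disj0 in auto)
  \<comment> \<open>The bound \<open>\<rho> / K\<close> makes the Lipschitz constant of every
    potential harmless off the tubes; \<open>norm q / 2\<close> keeps \<open>\<epsilon>\<close>
    below the speeds on the core lines.\<close>
  define \<epsilon> where "\<epsilon> = Min (insert (\<rho> / K) ((\<lambda>q. norm q / 2) ` V))"
  have "0 < \<epsilon>"
    using finV \<rho>(1) K V0 by (auto simp: \<epsilon>_def)
  have "\<epsilon> \<le> \<rho> / K" unfolding \<epsilon>_def using finV by (intro Min_le) auto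
  have \<epsilon>V: "\<epsilon> < norm q" if "q \<in> V" for q
  proof -
    have "\<epsilon> \<le> norm q / 2" unfolding \<epsilon>_def using finV that by (intro Min_le) auto
    moreover have "0 < norm q" using V0[OF that] by simp
    ultimately show ?thesis by linarith
  qed
  define a where "a x = \<epsilon> + (\<Sum>q\<in>V. ((norm q - \<epsilon>) / flat \<eta>) * flat (\<eta> - F q x))" for x
  have smooth_a: "smooth a"
    unfolding a_def F_def
    by (intro smooth_add smooth_const smooth_sum smooth_mult smooth_compose[OF smooth_flat]
        smooth_diff smooth_tube_fn)
  have F_per: "F q (x + z) = F q x" if "q \<in> V" "integer_vector z" for q x z
    using tube_fn_periodic[of "w q" "i q" "c q"] w[OF that(1)] that(2) by (simp add: F_def torus_periodic_def)
  have periodic_a: "torus_periodic a"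
    unfolding torus_periodic_def a_def by (simp add: F_per)
  have a_ge: "\<epsilon> \<le> a x" for x
    using \<epsilon>V flat_nonneg flat_pos[OF \<eta>(1)]
    by (auto simp: a_def less_imp_le intro!: sum_nonneg)
  have a_pos: "0 < a x" for x using a_ge[of x] \<open>0 < \<epsilon>\<close> by linarith
  have a_off: "a x = \<epsilon>" if "\<And>q. q \<in> V \<Longrightarrow> \<eta> \<le> F q x" for x
    using that by (auto simp: a_def flat_nonpos intro!: sum.neutral)
  have far: "\<eta> \<le> F q' x" if "q \<in> V" "q' \<in> V" "q' \<noteq> q" "F q x \<le> \<eta>" for q q' x
    using disj[of q q' x] that \<eta>(1) by auto
  have a_tube: "a x = \<epsilon> + (norm q - \<epsilon>) / flat \<eta> * flat (\<eta> - F q x)" if q: "q \<in> V" "F q x \<le> \<eta>" for q x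
  proof -
    have "(\<Sum>q\<in>V. ((norm q - \<epsilon>) / flat \<eta>) * flat (\<eta> - F q x)) =
        (\<Sum>q\<in>{q}. ((norm q - \<epsilon>) / flat \<eta>) * flat (\<eta> - F q x))"
      using finV q far[OF q(1) _ _ q(2)] by (intro sum.mono_neutral_right) (auto simp: flat_nonpos)
    then show ?thesis by (simp add: a_def)
  qed
  have a_tube_le: "a x \<le> norm q" if q: "q \<in> V" "F q x < \<eta>" for q x
  proof -
    have "flat (\<eta> - F q x) \<le> flat \<eta>" using tube_fn_nonneg by (intro flat_mono) (simp add: F_def)
    then have "(norm q - \<epsilon>) / flat \<eta> * flat (\<eta> - F q x) \<le> (norm q - \<epsilon>) / flat \<eta> * flat \<eta>"
      using \<epsilon>V[OF q(1)] flat_pos[OF \<eta>(1)] by (intro mult_left_mono) auto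
    then show ?thesis using a_tube[of q x] q flat_pos[OF \<eta>(1)] by simp
  qed
  have a_core: "a x = norm q" if "q \<in> V" "F q x = 0" for q x
    using a_tube[of q x] that \<eta>(1) flat_pos[OF \<eta>(1)] by simp
  have nonconst: "\<not> a constant_on UNIV"
  proof
    assume "a constant_on UNIV"
    then have const: "a x = a y" for x y by (auto simp: constant_on_def)
    obtain q where q: "q \<in> V" using neV by blast
    have "UNIV \<noteq> {i q}"
    proof
      assume "(UNIV :: 'n set) = {i q}"
      then have "CARD('n) = card {i q}" by simp
      then show False using assms(1) by simp
    qed
    then obtain b where b: "b \<noteq> i q" by blast
    define e where "e = (1 / (2 * w q $ i q)) *\<^sub>R axis b (1 :: real)"
    have tr: "transverse (w q) (i q) (c q + e - c q) $ b = 1 / 2"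
      using b i[OF q] by (simp add: transverse_def e_def axis_def)
    have "2 \<le> F q (c q + e)"
      using tube_fn_term_le[of "w q" "i q" "c q + e" "c q" b, unfolded tr] by (simp add: F_def)
    moreover have "F q (c q) = 0" by (simp add: F_def tube_fn_base)
    moreover have "continuous_on {0..1} (\<lambda>r. F q (c q + r *\<^sub>R e))"
      unfolding F_def
      by (rule continuous_on_compose2[OF smooth_continuous[OF smooth_tube_fn]]) (auto intro!: continuous_intros)
    ultimately obtain r where "F q (c q + r *\<^sub>R e) = \<eta>"
      using IVT'[of "\<lambda>r. F q (c q + r *\<^sub>R e)" 0 \<eta> 1] \<eta> by auto
    then have "a (c q + r *\<^sub>R e) = \<epsilon>"
      using a_tube[OF q, of "c q + r *\<^sub>R e"] by (simp add: flat_nonpos)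
    moreover have "a (c q) = norm q" using a_core[OF q] \<open>F q (c q) = 0\<close> by simp
    ultimately show False using const[of "c q" "c q + r *\<^sub>R e"] \<epsilon>V[OF q] by simp
  qed
  have upper: "\<exists>z\<in>P. y = x + (t + 2 * C / \<rho>) *\<^sub>R z" if t: "0 < t" and y: "y \<in> reachable_set a t x" for t x y
  proof -
    let ?T = "t + 2 * C / \<rho>"
    have T: "0 < ?T" using t C \<rho>(1) by (intro add_pos_nonneg) auto
    have bound: "p \<bullet> ((y - x) /\<^sub>R ?T) \<le> 1" if polar: "\<And>z. z \<in> P \<Longrightarrow> p \<bullet> z \<le> 1" for p
    proof -
      have "\<rho> *\<^sub>R sgn p \<in> P" using \<rho> by (intro subsetD[OF \<rho>(2)]) (simp add: norm_sgn)
      moreover have "p \<bullet> sgn p = norm p"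
        by (cases "p = 0") (simp_all add: sgn_div_norm dot_square_norm power2_eq_square)
      ultimately have "norm p * \<rho> \<le> 1"
        using polar[of "\<rho> *\<^sub>R sgn p"] by (simp add: mult.commute)
      then have np: "norm p \<le> 1 / \<rho>" using \<rho>(1) by (simp add: pos_le_divide_eq)
      obtain u where u1: "\<And>x y. \<bar>u x - u y\<bar> \<le> K * norm p * dist x y"
        and u2: "\<And>x. \<bar>u x - p \<bullet> x\<bar> \<le> C * norm p"
        and u3: "\<And>q x. q \<in> V \<Longrightarrow> F q x < \<eta> \<Longrightarrow>
         \<forall>\<^sub>F y in nhds x. \<bar>u y - u x\<bar> \<le> \<bar>p \<bullet> w q\<bar> / norm (w q) * norm (y - x)"
        using pot[of p] by blast
      have "u y - u x \<le> t"
      proof (rule reachable_set_potential_le[OF smooth_continuous[OF smooth_a] _ _ _ t y])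
        show "0 < a x" for x by (rule a_pos)
        have "(K * norm p)-lipschitz_on UNIV u"
          using u1 K by (intro lipschitz_onI) (auto simp: dist_real_def)
        then show "continuous_on UNIV u" by (rule lipschitz_on_continuous_on)
        show "\<exists>L\<ge>0. L * a x \<le> 1 \<and> (\<forall>\<^sub>F y in nhds x. \<bar>u y - u x\<bar> \<le> L * norm (y - x))" for x
        proof (cases "\<exists>q\<in>V. F q x < \<eta>")
          case True
          then obtain q where q: "q \<in> V" "F q x < \<eta>" by blast
          have sq: "s q > 0" using s[OF q(1)] by blast
          have "p \<bullet> q \<le> 1" "p \<bullet> (- q) \<le> 1" using q(1) VP sym polar by blast+
          then have "\<bar>p \<bullet> q\<bar> \<le> 1" by simp
          moreover have "\<bar>p \<bullet> w q\<bar> / norm (w q) = \<bar>p \<bullet> q\<bar> / norm q"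
            using sq by (simp add: w_def abs_mult)
          ultimately have le: "\<bar>p \<bullet> w q\<bar> / norm (w q) \<le> 1 / norm q"
            by (simp add: divide_right_mono)
          have "\<bar>p \<bullet> w q\<bar> / norm (w q) * a x \<le> 1 / norm q * norm q"
            using le a_tube_le[OF q] a_ge[of x] \<open>0 < \<epsilon>\<close> by (intro mult_mono) auto
          also have "\<dots> = 1" using V0[OF q(1)] by simp
          finally show ?thesis using u3[OF q] by (intro exI[of _ "\<bar>p \<bullet> w q\<bar> / norm (w q)"]) auto
        next
          case False
          then have "a x = \<epsilon>" by (intro a_off) force
          then have "K * norm p * a x \<le> K * (1 / \<rho>) * (\<rho> / K)"
            using \<open>\<epsilon> \<le> \<rho> / K\<close> \<open>0 < \<epsilon>\<close> np K \<rho>(1) by (intro mult_mono) auto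
          also have "\<dots> = 1" using K \<rho>(1) by simp
          finally show ?thesis
            using u1[of _ x] K
            by (intro exI[of _ "K * norm p"] conjI always_eventually allI) (simp_all add: dist_norm)
        qed
      qed
      then have "p \<bullet> (y - x) \<le> t + 2 * (C * norm p)"
        using u2[of x] u2[of y] by (simp add: inner_diff_right)
      also have "C * norm p \<le> C * (1 / \<rho>)" using np C by (rule mult_left_mono)
      finally have "p \<bullet> (y - x) \<le> ?T" by simp
      then show ?thesis using T by (simp add: pos_divide_le_eq inverse_eq_divide)
    qed
    have "0 \<in> P" using \<rho> by auto
    then have "(y - x) /\<^sub>R ?T \<in> P"
      by (rule in_convex_if_polar_le[OF P(3,2) _ bound])
    moreover have "y = x + ?T *\<^sub>R ((y - x) /\<^sub>R ?T)" using T by simp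
    ultimately show ?thesis by blast
  qed
  define T0 where "T0 = ?n / \<epsilon>"
  have T0: "0 < T0" using \<open>0 < \<epsilon>\<close> by (simp add: T0_def)
  have route: "\<exists>y. joins a (\<Sum>v\<in>U. T0 + \<nu> v * \<tau>) x y \<and>
      norm (y - x - \<tau> *\<^sub>R (\<Sum>v\<in>U. \<nu> v *\<^sub>R v)) \<le> card U * ?n"
    if "finite U" "U \<subseteq> V" "\<tau> \<ge> 0" "\<And>v. v \<in> V \<Longrightarrow> 0 \<le> \<nu> v" for U \<tau> \<nu> x
    using that(1,2)
  proof (induction arbitrary: x)
    case empty
    have "joins a 0 x (x + 0 *\<^sub>R 0)"
      using a_pos by (intro joins_line) (simp_all add: less_imp_le)
    then show ?case by auto
  next
    case (insert v U)
    then have v: "v \<in> V" by simp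
    obtain z where z: "integer_vector z" "norm ((x - c v) - z) \<le> ?n" by (rule integer_vector_near)
    define x1 where "x1 = c v + z"
    have "F v x1 = F v (c v)"
      using F_per[OF v z(1)] by (simp add: x1_def)
    then have F1: "F v x1 = 0" by (simp add: F_def tube_fn_base)
    have along: "F v (x1 + r *\<^sub>R v) = 0" for r
    proof -
      have "x1 + r *\<^sub>R v = x1 + (r / s v) *\<^sub>R w v" using s[OF v] by (simp add: w_def)
      then show ?thesis using F1 by (simp only: F_def tube_fn_along)
    qed
    have d1: "norm (x1 - x) \<le> ?n" using z(2) by (simp add: x1_def norm_minus_commute diff_diff_add)
    then have "joins a T0 x x1"
      using T0 a_ge \<open>0 < \<epsilon>\<close> by (intro joins_segment[where m = \<epsilon>]) (auto simp: T0_def)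
    moreover define x2 where "x2 = x1 + (\<nu> v * \<tau>) *\<^sub>R v"
    have "joins a (\<nu> v * \<tau>) x1 x2"
      unfolding x2_def using that(3,4) v a_core[OF v along] by (intro joins_line) auto
    ultimately have "joins a (T0 + \<nu> v * \<tau>) x x2" by (rule joins_trans)
    moreover obtain y where y: "joins a (\<Sum>v\<in>U. T0 + \<nu> v * \<tau>) x2 y"
      "norm (y - x2 - \<tau> *\<^sub>R (\<Sum>v\<in>U. \<nu> v *\<^sub>R v)) \<le> card U * ?n"
      using insert.IH insert.prems by blast
    ultimately have "joins a ((T0 + \<nu> v * \<tau>) + (\<Sum>v\<in>U. T0 + \<nu> v * \<tau>)) x y"
      by (blast intro: joins_trans)
    moreover have "y - x - \<tau> *\<^sub>R (\<Sum>v\<in>insert v U. \<nu> v *\<^sub>R v) =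
        (y - x2 - \<tau> *\<^sub>R (\<Sum>v\<in>U. \<nu> v *\<^sub>R v)) + (x1 - x)"
      using insert.hyps by (simp add: x2_def algebra_simps)
    then have "norm (y - x - \<tau> *\<^sub>R (\<Sum>v\<in>insert v U. \<nu> v *\<^sub>R v)) \<le> card U * ?n + ?n"
      using norm_triangle_le[OF add_mono[OF y(2) d1]] by (simp only:)
    ultimately show ?case using insert.hyps by (auto simp: algebra_simps intro!: exI[of _ y])
  qed
  define T where "T = card V * T0"
  have lower: "\<exists>y\<in>reachable_set a t x. norm (y - x - (t - T) *\<^sub>R z) \<le> card V * ?n"
    if t: "T \<le> t" and z: "z \<in> P" for t x z
  proof -
    obtain \<nu> where \<nu>: "\<And>v. v \<in> V \<Longrightarrow> 0 \<le> \<nu> v" "sum \<nu> V = 1" "(\<Sum>v\<in>V. \<nu> v *\<^sub>R v) = z"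
      using z hull convex_hull_finite[OF finV] by auto
    have "(\<Sum>v\<in>V. T0 + \<nu> v * (t - T)) = t"
      using \<nu>(2) by (simp add: sum.distrib T_def flip: sum_distrib_right)
    then obtain y where y: "joins a t x y" "norm (y - x - (t - T) *\<^sub>R z) \<le> card V * ?n"
      using route[OF finV subset_refl, of "t - T" \<nu> x] t \<nu> by auto
    then show ?thesis using joins_reachable by blast
  qed
  have "has_limit_shape a P"
    by (rule has_limit_shapeI[OF P(1,2) upper _ _ lower]) (use C \<rho>(1) T0 in \<open>auto simp: T_def\<close>)
  then show ?thesis
    using smooth_a periodic_a nonconst a_pos by blast
qed

end
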